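(* Let $\mathbb{T}^2=(\mathbb{R}/\mathbb{Z})^2$ with its flat metric, and let $0=\lambda_1(\mathbb{T}^2)\le\lambda_2(\mathbb{T}^2)\le\cdots$ be the eigenvalues of $-\Delta_{\mathbb{T}^2}$, listed in non-decreasing order and counted with multiplicity. An eigenvalue $\lambda$ of $-\Delta_{\mathbb{T}^2}$ is Courant-sharp if and only if $\lambda=\lambda_k(\mathbb{T}^2)$ for some $k\in\{1,2,3,4,5\}$, i.e. if and only if $\lambda\in\{0,4\pi^2\}$.
   Context: $-\Delta_{\mathbb{T}^2}$ is the Laplace–Beltrami operator of the flat torus $\mathbb{T}^2=(\mathbb{R}/\mathbb{Z})^2$. For an eigenfunction $u$ of $-\Delta_{\mathbb{T}^2}$, the nodal domains of $u$ are the connected components of $\mathbb{T}^2\setminus u^{-1}(\{0\})$, and $\mu(u)$ denotes their number. For an eigenvalue $\lambda$, $\nu(\lambda)=\min\{k\ge 1:\lambda_k(\mathbb{T}^2)=\lambda\}$. An eigenvalue $\lambda$ is called Courant-sharp if there exists an eigenfunction $u$ associated with $\lambda$ with $\mu(u)=\nu(\lambda)$. *)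

theory Defs
  imports "HOL-Analysis.Analysis"
begin

text \<open>Functions on the flat torus (R/Z)^2 are represented as Z^2-periodic functions on R x R.\<close>

definition periodic2 :: "(real \<times> real \<Rightarrow> real) \<Rightarrow> bool" where
  "periodic2 u \<longleftrightarrow> (\<forall>x y. u (x + 1, y) = u (x, y) \<and> u (x, y + 1) = u (x, y))"

definition solves_helmholtz :: "real \<Rightarrow> (real \<times> real \<Rightarrow> real) \<Rightarrow> bool" where
  "solves_helmholtz lam u \<longleftrightarrow> periodic2 u \<and> continuous_on UNIV u \<and>
     (\<exists>ux uy uxx uyy :: real \<times> real \<Rightarrow> real.
        continuous_on UNIV uxx \<and> continuous_on UNIV uyy \<and>
        (\<forall>x y. ((\<lambda>t. u (t, y)) has_real_derivative ux (x, y)) (at x) \<and>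
               ((\<lambda>t. ux (t, y)) has_real_derivative uxx (x, y)) (at x) \<and>
               ((\<lambda>t. u (x, t)) has_real_derivative uy (x, y)) (at y) \<and>
               ((\<lambda>t. uy (x, t)) has_real_derivative uyy (x, y)) (at y)) \<and>
        (\<forall>p. - (uxx p + uyy p) = lam * u p))"

definition torus_eigenfunction :: "real \<Rightarrow> (real \<times> real \<Rightarrow> real) \<Rightarrow> bool" where
  "torus_eigenfunction lam u \<longleftrightarrow> solves_helmholtz lam u \<and> (\<exists>p. u p \<noteq> 0)"

definition torus_eigenvalue :: "real \<Rightarrow> bool" where
  "torus_eigenvalue lam \<longleftrightarrow> (\<exists>u. torus_eigenfunction lam u)"

definition lin_indep_fun :: "(real \<times> real \<Rightarrow> real) set \<Rightarrow> bool" where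
  "lin_indep_fun F \<longleftrightarrow> finite F \<and>
     (\<forall>c. (\<forall>p. (\<Sum>f\<in>F. c f * f p) = 0) \<longrightarrow> (\<forall>f\<in>F. c f = 0))"

definition eig_mult :: "real \<Rightarrow> nat" where
  "eig_mult lam = Sup {card F | F. F \<subseteq> {u. solves_helmholtz lam u} \<and> lin_indep_fun F}"

text \<open>nu(lambda) = min{k \<ge> 1. lambda_k = lambda} = 1 + number of eigenvalues below lambda,
  counted with multiplicity.\<close>
definition nu :: "real \<Rightarrow> nat" where
  "nu lam = 1 + (\<Sum>m\<in>{m. torus_eigenvalue m \<and> m < lam}. eig_mult m)"

definition lambda_k :: "nat \<Rightarrow> real" where
  "lambda_k k = (THE lam. torus_eigenvalue lam \<and> nu lam \<le> k \<and> k < nu lam + eig_mult lam)"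

text \<open>The torus (R/Z)^2 realised (homeomorphically) as S^1 x S^1 in C x C.\<close>
definition torus_embed :: "real \<times> real \<Rightarrow> complex \<times> complex" where
  "torus_embed p = (cis (2 * pi * fst p), cis (2 * pi * snd p))"

definition nodal_domains :: "(real \<times> real \<Rightarrow> real) \<Rightarrow> (complex \<times> complex) set set" where
  "nodal_domains u = components (torus_embed ` {p. u p \<noteq> 0})"

definition num_nodal_domains :: "(real \<times> real \<Rightarrow> real) \<Rightarrow> nat" where
  "num_nodal_domains u = card (nodal_domains u)"

definition courant_sharp :: "real \<Rightarrow> bool" where
  "courant_sharp lam \<longleftrightarrow> (\<exists>u. torus_eigenfunction lam u \<and> num_nodal_domains u = nu lam)"

end

theory Submission
  imports Defs
begin

text \<open>Let u be an eigenfunction for 4 pi^2 N with n nodal domains. On a nodal domain G, Wirtinger's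
  inequality on the horizontal and vertical slices gives 4 N \<ge> 1/W^2 + 1/H^2, where W and H are the
  suprema of the lengths of the horizontal and vertical segments in G. On each line u is a trigonometric
  polynomial of degree at most d, the integer part of sqrt N, so a line meets at most 2 d nodal domains.
  Hence the widths W of all nodal domains sum up to at most 2 d, and so do the heights H; by convexity
  n^2 \<le> 8 N d^2. Since nu is asymptotic to pi N and sqrt 8 < pi, this forces n < nu for large N,
  and a finite computation shows the same for all N \<ge> 2 except 4 and 25. For these two, the same argument is applied
  to the directions (1, b) and (-b, 1) with b = 1 and b = 2 instead of the coordinate axes.\<close>

text \<open>Slicing takes the place of Faber-Krahn: only an inequality on segments is used, and a
  function cut off to a nodal domain enters through its values alone, so nodal lines may be as
  irregular as they like. The obstacle is that a nodal domain may wind around the torus and contain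
  arbitrarily long segments. Its lift to the plane is a periodic, often disconnected set; its width
  is capped at one period, and a capped width contributes 0 to the spectral bound. The convexity
  step reads: with n domains the mean width is at most 2 d / n, so the values 1/W^2 sum to at least
  n^3 / (4 d^2), likewise for the heights, and together they are at most 4 N n. For a square N the
  axes gain nothing from rounding, since d = sqrt N. Tilted directions amount to a pullback under
  multiplication by 1 + b i, after which d is the integer part of sqrt ((1 + b^2) N), and rounding
  this down can gain enough.\<close>

section \<open>Wirtinger's inequality on nodal intervals\<close>

text \<open>With c(t) = - k tan (k (t - m)) one has f'^2 - k^2 f^2 = (f' - c f)^2 + (c f^2)'; as k (b - a) < pi,
  c is bounded on [a, b] and the boundary terms vanish.\<close>
lemma wirtinger_strict:
  fixes f f' f'' :: "real \<Rightarrow> real"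
  assumes ab: "a \<le> b" and fa: "f a = 0" and fb: "f b = 0"
    and f': "\<And>t. (f has_real_derivative f' t) (at t)"
    and f'': "\<And>t. (f' has_real_derivative f'' t) (at t)"
    and cont: "continuous_on UNIV f''"
    and k: "0 \<le> k" "k * (b - a) < pi"
  shows "k\<^sup>2 * integral {a..b} (\<lambda>t. (f t)\<^sup>2) \<le> - integral {a..b} (\<lambda>t. f t * f'' t)"
proof -
  define m where "m = (a + b) / 2"
  define c where "c = (\<lambda>t. - k * tan (k * (t - m)))"
  define h where "h = (\<lambda>t. - f t * f'' t - k\<^sup>2 * (f t)\<^sup>2 - (f' t - c t * f t)\<^sup>2)"
  have c: "(c has_real_derivative - k\<^sup>2 - (c t)\<^sup>2) (at t)" if "t \<in> {a..b}" for t
  proof -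
    have "\<bar>t - m\<bar> \<le> (b - a) / 2" using that by (auto simp: m_def field_simps abs_le_iff)
    then have "\<bar>k * (t - m)\<bar> \<le> k * ((b - a) / 2)"
      unfolding abs_mult using k(1) by (intro mult_mono) auto
    also have "\<dots> < pi / 2" using k(2) by simp
    finally have lt: "\<bar>k * (t - m)\<bar> < pi / 2" .
    then have "- (pi / 2) < k * (t - m)" "k * (t - m) < pi / 2"
      by (simp_all only: abs_less_iff) linarith
    then have nz: "cos (k * (t - m)) \<noteq> 0" using cos_gt_zero_pi by force
    have "(c has_real_derivative - k * (inverse ((cos (k * (t - m)))\<^sup>2) * k)) (at t)"
      unfolding c_def using nz by (auto intro!: derivative_eq_intros)
    moreover have "inverse ((cos (k * (t - m)))\<^sup>2) = 1 + (tan (k * (t - m)))\<^sup>2"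
      using tan_sec[OF nz] by (simp add: power_inverse)
    ultimately show ?thesis by (simp add: c_def algebra_simps power2_eq_square)
  qed
  have "(h has_integral (c b * (f b)\<^sup>2 - f b * f' b) - (c a * (f a)\<^sup>2 - f a * f' a)) {a..b}"
  proof (rule fundamental_theorem_of_calculus[OF ab])
    fix t assume t: "t \<in> {a..b}"
    have "((\<lambda>t. c t * (f t)\<^sup>2 - f t * f' t) has_real_derivative h t) (at t)"
      unfolding h_def
      by (rule derivative_eq_intros c[OF t] f' f'' refl)+ (simp add: algebra_simps power2_eq_square)
    then show "((\<lambda>t. c t * (f t)\<^sup>2 - f t * f' t) has_vector_derivative h t) (at t within {a..b})"
      by (simp add: has_real_derivative_iff_has_vector_derivative has_vector_derivative_at_within)
  qed
  then have h0: "(h has_integral 0) {a..b}" by (simp add: fa fb)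
  have cf: "continuous_on S f" "continuous_on S f''" for S
    using f' cont by (auto intro: DERIV_continuous_on DERIV_subset continuous_on_subset has_field_derivative_at_within)
  have i1: "(\<lambda>t. f t * f'' t) integrable_on {a..b}" "(\<lambda>t. (f t)\<^sup>2) integrable_on {a..b}"
    by (intro integrable_continuous_interval continuous_intros cf)+
  have "((\<lambda>t. - (f t * f'' t) - k\<^sup>2 * (f t)\<^sup>2) has_integral
      (- integral {a..b} (\<lambda>t. f t * f'' t) - k\<^sup>2 * integral {a..b} (\<lambda>t. (f t)\<^sup>2))) {a..b}"
    using i1 by (intro has_integral_diff has_integral_neg has_integral_mult_right integrable_integral)
  from has_integral_le[OF h0 this] show ?thesis by (simp add: h_def)
qed

text \<open>In the limiting case where \<open>k * (b - a)\<^sup>2\<close> equals pi^2 the multiplier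
  tan blows up at the endpoints, so the strict form is applied to \<open>z * k\<close> with
  \<open>z < 1\<close>, and \<open>z\<close> tends to 1. Here \<open>k\<close> is the square of the
  frequency, unlike in \<open>wirtinger_strict\<close>.\<close>

lemma wirtinger:
  fixes f f' f'' :: "real \<Rightarrow> real"
  assumes ab: "a \<le> b" and fa: "f a = 0" and fb: "f b = 0"
    and f': "\<And>t. (f has_real_derivative f' t) (at t)"
    and f'': "\<And>t. (f' has_real_derivative f'' t) (at t)"
    and cont: "continuous_on UNIV f''"
    and k: "0 \<le> k" "k * (b - a)\<^sup>2 \<le> pi\<^sup>2"
  shows "k * integral {a..b} (\<lambda>t. (f t)\<^sup>2) \<le> - integral {a..b} (\<lambda>t. f t * f'' t)"
proof (rule field_le_mult_one_interval)
  fix z :: real assume z: "0 < z" "z < 1"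
  have "z * (k * (b - a)\<^sup>2) < pi\<^sup>2"
  proof (cases "k * (b - a)\<^sup>2 = 0")
    case False
    then have "z * (k * (b - a)\<^sup>2) < k * (b - a)\<^sup>2" using z k by simp
    then show ?thesis using k by linarith
  qed auto
  then have "(sqrt (z * k) * (b - a))\<^sup>2 < pi\<^sup>2" using z k by (simp add: power_mult_distrib)
  then have "sqrt (z * k) * (b - a) < pi" by (rule power_less_imp_less_base) simp
  from wirtinger_strict[OF ab fa fb f' f'' cont _ this]
  show "z * (k * integral {a..b} (\<lambda>t. (f t)\<^sup>2)) \<le> - integral {a..b} (\<lambda>t. f t * f'' t)"
    using z k by (simp add: mult.assoc)
qed

text \<open>The zeros of \<open>f\<close> cut \<open>[a, b]\<close> into gaps, each inside
  \<open>A\<close> or disjoint from it; the first kind obeys Wirtinger's inequality, the second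
  contributes 0 to both sides. Keeping \<open>f''\<close> of the uncut \<open>f\<close> on the right
  avoids differentiating the cutoff, which may have corners.\<close>

lemma wirtinger_pieces:
  fixes f f' f'' :: "real \<Rightarrow> real"
  defines "g \<equiv> \<lambda>A t. if t \<in> A then f t else 0"
  assumes f': "\<And>t. (f has_real_derivative f' t) (at t)"
    and f'': "\<And>t. (f' has_real_derivative f'' t) (at t)"
    and cont: "continuous_on UNIV f''"
    and g: "continuous_on UNIV (g A)"
    and sat: "\<And>c d. \<forall>t\<in>{c<..<d}. f t \<noteq> 0 \<Longrightarrow> {c<..<d} \<subseteq> A \<or> {c<..<d} \<inter> A = {}"
    and k: "0 \<le> k" "\<And>c d. c < d \<Longrightarrow> {c<..<d} \<subseteq> A \<Longrightarrow> k * (d - c)\<^sup>2 \<le> pi\<^sup>2"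
    and "a < b" "f a = 0" "f b = 0" "finite {t \<in> {a<..<b}. f t = 0}"
  shows "k * integral {a..b} (\<lambda>t. (g A t)\<^sup>2) \<le> - integral {a..b} (\<lambda>t. g A t * f'' t)"
  using assms(9-)
proof (induction "card {t \<in> {a<..<b}. f t = 0}" arbitrary: a b rule: less_induct)
  case less
  have int: "(\<lambda>t. g A t * f'' t) integrable_on {x..y}" "(\<lambda>t. (g A t)\<^sup>2) integrable_on {x..y}" for x y
    by (intro integrable_continuous_interval continuous_intros continuous_on_subset[OF g]
        continuous_on_subset[OF cont] subset_UNIV)+
  show ?case
  proof (cases "{t \<in> {a<..<b}. f t = 0} = {}")
    case True
    then have nz: "\<forall>t\<in>{a<..<b}. f t \<noteq> 0" by auto
    from sat[OF nz] show ?thesis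
    proof
      assume A: "{a<..<b} \<subseteq> A"
      have eq: "g A t = f t" if "t \<in> {a..b}" for t
        using that A less.prems by (cases "t = a \<or> t = b") (auto simp: g_def subset_iff)
      have "k * integral {a..b} (\<lambda>t. (f t)\<^sup>2) \<le> - integral {a..b} (\<lambda>t. f t * f'' t)"
        using less.prems A k by (intro wirtinger[OF _ _ _ f' f'' cont]) auto
      moreover have "integral {a..b} (\<lambda>t. (g A t)\<^sup>2) = integral {a..b} (\<lambda>t. (f t)\<^sup>2)"
        "integral {a..b} (\<lambda>t. g A t * f'' t) = integral {a..b} (\<lambda>t. f t * f'' t)"
        by (rule integral_cong; simp add: eq)+
      ultimately show ?thesis by simp
    next
      assume A: "{a<..<b} \<inter> A = {}"
      have eq: "g A t = 0" if "t \<in> {a..b}" for t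
        using that A less.prems by (cases "t = a \<or> t = b") (auto simp: g_def disjoint_iff)
      have "integral {a..b} (\<lambda>t. (g A t)\<^sup>2) = integral {a..b} (\<lambda>t. 0)"
        "integral {a..b} (\<lambda>t. g A t * f'' t) = integral {a..b} (\<lambda>t. 0)"
        by (rule integral_cong; simp add: eq)+
      then show ?thesis by simp
    qed
  next
    case False
    then obtain z where z: "a < z" "z < b" "f z = 0" by auto
    let ?Z = "\<lambda>x y. {t \<in> {x<..<y}. f t = 0}"
    have "?Z a z \<subset> ?Z a b" "?Z z b \<subset> ?Z a b"
      using z by (auto simp: psubset_eq set_eq_iff)
    then have lt: "card (?Z a z) < card (?Z a b)" "card (?Z z b) < card (?Z a b)"
      and fin: "finite (?Z a z)" "finite (?Z z b)"
      using less.prems(4) psubset_card_mono finite_subset by blast+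
    have "integral {a..z} h + integral {z..b} h = integral {a..b} h"
      if "\<And>x y. h integrable_on {x..y}" for h :: "real \<Rightarrow> real"
      by (rule Henstock_Kurzweil_Integration.integral_combine) (use z that in auto)
    note comb = this[OF int(1)] this[OF int(2)]
    show ?thesis
      using less.hyps[OF lt(1) z(1) less.prems(2) z(3) fin(1)]
        less.hyps[OF lt(2) z(2,3) less.prems(3) fin(2)]
      by (simp flip: comb add: distrib_left)
  qed
qed

lemma integral_periodic:
  fixes f :: "real \<Rightarrow> real"
  assumes per: "\<And>t. f (t + 1) = f t" and cont: "continuous_on UNIV f"
  shows "integral {z..z + 1} f = integral {0..1} f"
proof -
  have int: "f integrable_on {x..y}" for x y
    by (intro integrable_continuous_interval continuous_on_subset[OF cont] subset_UNIV)
  define F where "F = (\<lambda>x. integral {0..x} f)"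
  have shift: "integral {x + 1..y + 1} f = integral {x..y} f" for x y
  proof -
    have "(f has_integral integral {x + 1..y + 1} f) {x + 1..y + 1}" using int by blast
    from has_integral_affinity'[OF this[folded box_real], of 1 1] per
    have "(f has_integral integral {x + 1..y + 1} f) {x..y}" by (simp add: add.commute)
    then show ?thesis by (simp add: integral_unique)
  qed
  have comb: "integral {a..b} f + integral {b..c} f = integral {a..c} f" if "a \<le> b" "b \<le> c" for a b c
    using Henstock_Kurzweil_Integration.integral_combine[OF that int] .
  have base: "integral {w..w + 1} f = integral {0..1} f" if "0 \<le> w" for w
    using comb[of 0 w "w+1"] comb[of 0 1 "w+1"] shift[of 0 w] that by (simp add: add.commute)
  obtain n :: nat where n: "- z \<le> real n" using real_arch_simple by blast
  have "integral {z + real m..z + real m + 1} f = integral {z..z + 1} f" for m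
  proof (induction m)
    case (Suc m)
    then show ?case using shift[of "z + real m" "z + real m + 1"] by (simp add: add_ac)
  qed simp
  from this[of n] base[of "z + real n"] n show ?thesis by simp
qed

text \<open>Starting the period at a zero reduces the claim to \<open>wirtinger_pieces\<close>.
  Without zeros \<open>A\<close> is empty or the whole line; in the latter case arbitrarily long
  segments force \<open>k = 0\<close>, and what remains is that the integral of
  \<open>f * f''\<close> over a period is minus that of the square of \<open>f'\<close>.\<close>

lemma wirtinger_periodic:
  fixes f f' f'' :: "real \<Rightarrow> real"
  defines "g \<equiv> \<lambda>A t. if t \<in> A then f t else 0"
  assumes f': "\<And>t. (f has_real_derivative f' t) (at t)"
    and f'': "\<And>t. (f' has_real_derivative f'' t) (at t)"
    and cont: "continuous_on UNIV f''"
    and g: "continuous_on UNIV (g A)"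
    and per: "\<And>t. f (t + 1) = f t" "\<And>t. t + 1 \<in> A \<longleftrightarrow> t \<in> A" "\<And>t. f'' (t + 1) = f'' t"
      "\<And>t. f' (t + 1) = f' t"
    and sat: "\<And>c d. \<forall>t\<in>{c<..<d}. f t \<noteq> 0 \<Longrightarrow> {c<..<d} \<subseteq> A \<or> {c<..<d} \<inter> A = {}"
    and k: "0 \<le> k" "\<And>c d. c < d \<Longrightarrow> {c<..<d} \<subseteq> A \<Longrightarrow> k * (d - c)\<^sup>2 \<le> pi\<^sup>2"
    and fin: "(\<forall>t. f t = 0) \<or> (\<forall>a b. finite {t \<in> {a<..<b}. f t = 0})"
  shows "k * integral {0..1} (\<lambda>t. (g A t)\<^sup>2) \<le> - integral {0..1} (\<lambda>t. g A t * f'' t)"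
proof (cases "\<exists>z. f z = 0")
  case True
  then obtain z where z: "f z = 0" by blast
  show ?thesis
  proof (cases "\<forall>t. f t = 0")
    case True
    then have "g A = (\<lambda>t. 0)" by (auto simp: g_def)
    then show ?thesis by simp
  next
    case False
    have "k * integral {z..z+1} (\<lambda>t. (g A t)\<^sup>2) \<le> - integral {z..z+1} (\<lambda>t. g A t * f'' t)"
      unfolding g_def
      by (rule wirtinger_pieces[OF f' f'' cont g[unfolded g_def] sat k])
         (use fin False z per in auto)
    moreover have "integral {z..z+1} (\<lambda>t. (g A t)\<^sup>2) = integral {0..1} (\<lambda>t. (g A t)\<^sup>2)"
      "integral {z..z+1} (\<lambda>t. g A t * f'' t) = integral {0..1} (\<lambda>t. g A t * f'' t)"
      by (intro integral_periodic continuous_intros g cont; simp add: g_def per)+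
    ultimately show ?thesis by simp
  qed
next
  case nz: False
  show ?thesis
  proof (cases "A = {}")
    case True
    then show ?thesis by (simp add: g_def)
  next
    case False
    then obtain s where s: "s \<in> A" by blast
    have UN: "{s - n<..<s + n} \<subseteq> A" if "n > 0" for n
    proof -
      have "s \<in> {s - n<..<s + n} \<inter> A" using s that by simp
      then show ?thesis using sat[of "s - n" "s + n"] nz by blast
    qed
    have A: "A = UNIV"
    proof (rule set_eqI)
      fix t
      have "t \<in> {s - (\<bar>t - s\<bar> + 1)<..<s + (\<bar>t - s\<bar> + 1)}" by auto
      with UN[of "\<bar>t - s\<bar> + 1"] show "t \<in> A \<longleftrightarrow> t \<in> UNIV" by auto
    qed
    have k0: "k = 0"
    proof (rule ccontr)
      assume "k \<noteq> 0"
      then have kp: "k > 0" using k(1) by simp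
      \<comment> \<open>A length for which \<open>k * L\<^sup>2\<close> exceeds pi^2; 4 is the first
        integer above pi.\<close>
      define L where "L = 4 / sqrt k"
      have "L > 0" "k * L\<^sup>2 = 16" using kp by (simp_all add: L_def power_divide)
      moreover have "k * (L - 0)\<^sup>2 \<le> pi\<^sup>2" using k(2)[of 0 L] A \<open>L > 0\<close> by auto
      moreover have "pi\<^sup>2 < 4\<^sup>2" using pi_less_4 by (intro power_strict_mono) auto
      ultimately show False by simp
    qed
    have cf: "continuous_on S f" "continuous_on S f'" "continuous_on S f''" for S
      using f' f'' cont by (auto intro: DERIV_continuous_on continuous_on_subset has_field_derivative_at_within)
    have "((\<lambda>t. f' t * f' t + f t * f'' t) has_integral f 1 * f' 1 - f 0 * f' 0) {0..1}"
    proof (rule fundamental_theorem_of_calculus)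
      fix t
      have "((\<lambda>t. f t * f' t) has_real_derivative f' t * f' t + f t * f'' t) (at t)"
        by (rule derivative_eq_intros f' f'' refl)+ simp
      then show "((\<lambda>t. f t * f' t) has_vector_derivative f' t * f' t + f t * f'' t) (at t within {0..1})"
        by (simp add: has_real_derivative_iff_has_vector_derivative has_vector_derivative_at_within)
    qed simp
    moreover have "f 1 = f 0" "f' 1 = f' 0" using per(1,4)[of 0] by simp_all
    ultimately have h0: "((\<lambda>t. f' t * f' t + f t * f'' t) has_integral 0) {0..1}" by simp
    have "(\<lambda>t. f t * f'' t) integrable_on {0..1}"
      by (intro integrable_continuous_interval continuous_intros cf)
    from has_integral_le[OF integrable_integral[OF this] h0]
    show ?thesis by (simp add: k0 g_def A)
  qed
qed

section \<open>The energy of a saturated set\<close>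

text \<open>Says that \<open>G\<close> is a union of components of the set where \<open>v\<close>
  does not vanish. Single components would be too narrow a notion: the lift of a nodal domain to the
  plane, and its trace on a line, are usually disconnected.\<close>

definition saturated :: "('a::topological_space \<Rightarrow> real) \<Rightarrow> 'a set \<Rightarrow> bool" where
  "saturated v G \<longleftrightarrow> G \<subseteq> {p. v p \<noteq> 0} \<and>
     (\<forall>S. connected S \<and> S \<subseteq> {p. v p \<noteq> 0} \<and> S \<inter> G \<noteq> {} \<longrightarrow> S \<subseteq> G)"

lemma saturatedD:
  assumes "saturated v G"
  shows "\<And>p. p \<in> G \<Longrightarrow> v p \<noteq> 0"
    and "\<And>S. connected S \<Longrightarrow> (\<And>p. p \<in> S \<Longrightarrow> v p \<noteq> 0) \<Longrightarrow> S \<inter> G \<noteq> {} \<Longrightarrow> S \<subseteq> G"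
  using assms unfolding saturated_def by blast+

lemma saturated_ball:
  fixes v :: "'a::real_normed_vector \<Rightarrow> real"
  assumes v: "continuous_on UNIV v" and sat: "saturated v G" and p: "v p \<noteq> 0"
  obtains e where "e > 0" "ball p e \<subseteq> G \<or> ball p e \<inter> G = {}"
proof -
  have "open {p. v p \<noteq> 0}"
    using v by (auto intro: open_Collect_neq continuous_on_const)
  then obtain e where e: "e > 0" "ball p e \<subseteq> {p. v p \<noteq> 0}"
    using p unfolding open_contains_ball by blast
  have "ball p e \<subseteq> G" if "ball p e \<inter> G \<noteq> {}"
    by (rule saturatedD(2)[OF sat _ _ that]) (use e in auto)
  then show ?thesis using that e by blast
qed

lemma saturated_open:
  fixes v :: "'a::real_normed_vector \<Rightarrow> real"
  assumes v: "continuous_on UNIV v" and sat: "saturated v G"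
  shows "open G"
  unfolding open_contains_ball
proof
  fix p assume p: "p \<in> G"
  obtain e where e: "e > 0" "ball p e \<subseteq> G \<or> ball p e \<inter> G = {}"
    using saturated_ball[OF v sat saturatedD(1)[OF sat p]] .
  then have "ball p e \<subseteq> G" using p by (metis centre_in_ball disjoint_iff)
  with e show "\<exists>e>0. ball p e \<subseteq> G" by blast
qed

text \<open>Membership in \<open>G\<close> is locally constant where \<open>v\<close> is nonzero,
  and at a zero of \<open>v\<close> the cutoff is squeezed by the absolute value of
  \<open>v\<close>.\<close>

lemma saturated_cutoff_continuous:
  fixes v :: "'a::real_normed_vector \<Rightarrow> real"
  assumes v: "continuous_on UNIV v" and sat: "saturated v G"
  shows "continuous_on UNIV (\<lambda>p. if p \<in> G then v p else 0)"
    (is "continuous_on UNIV ?g")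
proof -
  have vc: "isCont v p" for p using v by (simp add: continuous_on_eq_continuous_at)
  have "isCont ?g p" for p
  proof (cases "v p = 0")
    case True
    then have g0: "?g p = 0" by simp
    have "(v \<longlongrightarrow> 0) (at p)" using vc[of p] True by (simp add: isCont_def)
    then have "((\<lambda>x. \<bar>v x\<bar>) \<longlongrightarrow> 0) (at p)" by (simp add: tendsto_rabs_zero)
    then have "(?g \<longlongrightarrow> 0) (at p)"
      by (rule Lim_null_comparison[rotated]) (auto intro!: always_eventually)
    then show ?thesis unfolding isCont_def g0 .
  next
    case False
    obtain e where e: "e > 0" "ball p e \<subseteq> G \<or> ball p e \<inter> G = {}"
      using saturated_ball[OF v sat False] .
    have nb: "\<forall>\<^sub>F x in nhds p. x \<in> ball p e"
      using e(1) by (intro eventually_nhds_in_open) auto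
    from e(2) show ?thesis
    proof
      assume *: "ball p e \<subseteq> G"
      have "\<forall>\<^sub>F x in nhds p. ?g x = v x" by (rule eventually_mono[OF nb]) (use * in auto)
      then show ?thesis using vc[of p] isCont_cong[of ?g v p] by simp
    next
      assume *: "ball p e \<inter> G = {}"
      have "\<forall>\<^sub>F x in nhds p. ?g x = (\<lambda>_. 0) x" by (rule eventually_mono[OF nb]) (use * in auto)
      then show ?thesis using isCont_cong[of ?g "\<lambda>_. 0" p] by simp
    qed
  qed
  then show ?thesis by (simp add: continuous_on_eq_continuous_at)
qed

text \<open>The dichotomy for a trigonometric polynomial on a line. Lines on which it vanishes
  identically do occur, but the cutoff is zero on them.\<close>

definition finite_zeros :: "(real \<Rightarrow> real) \<Rightarrow> bool" where
  "finite_zeros f \<longleftrightarrow> (\<forall>t. f t = 0) \<or> (\<forall>a b. finite {t \<in> {a<..<b}. f t = 0})"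

text \<open>The constant k plays the role of (pi/L)^2, where L is the supremum of the lengths of the
  horizontal segments in G; k = 0 covers an infinite L.\<close>
definition horizontal_bound :: "(real \<times> real) set \<Rightarrow> real \<Rightarrow> bool" where
  "horizontal_bound G k \<longleftrightarrow> 0 \<le> k \<and>
     (\<forall>y c d. c < d \<longrightarrow> (\<lambda>t. (t, y)) ` {c<..<d} \<subseteq> G \<longrightarrow> k * (d - c)\<^sup>2 \<le> pi\<^sup>2)"

definition periodic_set :: "(real \<times> real) set \<Rightarrow> bool" where
  "periodic_set G \<longleftrightarrow> (\<forall>x y. ((x + 1, y) \<in> G \<longleftrightarrow> (x, y) \<in> G) \<and> ((x, y + 1) \<in> G \<longleftrightarrow> (x, y) \<in> G))"

text \<open>Wirtinger's inequality on every horizontal line, integrated over the height. The trace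
  of \<open>G\<close> on a line inherits saturation and periodicity, so no line has to be
  excluded.\<close>

lemma horizontal_energy:
  fixes v vx vxx :: "real \<times> real \<Rightarrow> real"
  assumes per: "periodic2 v" "periodic2 vx" "periodic2 vxx" "periodic_set G"
    and cont: "continuous_on UNIV v" "continuous_on UNIV vxx"
    and vx: "\<And>x y. ((\<lambda>t. v (t, y)) has_real_derivative vx (x, y)) (at x)"
    and vxx: "\<And>x y. ((\<lambda>t. vx (t, y)) has_real_derivative vxx (x, y)) (at x)"
    and sat: "saturated v G" and bd: "horizontal_bound G k"
    and fin: "\<And>y. finite_zeros (\<lambda>t. v (t, y))"
  defines "g \<equiv> \<lambda>p. if p \<in> G then v p else 0"
  shows "k * integral (cbox (0, 0) (1, 1)) (\<lambda>p. (g p)\<^sup>2) \<le> - integral (cbox (0, 0) (1, 1)) (\<lambda>p. g p * vxx p)"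
proof -
  have g: "continuous_on UNIV g" unfolding g_def by (rule saturated_cutoff_continuous[OF cont(1) sat])
  have sl: "continuous_on UNIV (\<lambda>t. h (t, y))" if "continuous_on UNIV h"
    for h :: "real \<times> real \<Rightarrow> real" and y
    by (rule continuous_on_compose2[OF that]) (auto intro!: continuous_intros)
  have line: "k * integral {0..1} (\<lambda>x. (g (x, y))\<^sup>2) \<le> - integral {0..1} (\<lambda>x. g (x, y) * vxx (x, y))" for y
  proof -
    define A where "A = {t. (t, y) \<in> G}"
    have sA: "{c<..<d} \<subseteq> A \<or> {c<..<d} \<inter> A = {}" if nz: "\<forall>t\<in>{c<..<d}. v (t, y) \<noteq> 0" for c d
    proof -
      have "connected ((\<lambda>t. (t, y)) ` {c<..<d})"
        by (intro connected_continuous_image continuous_intros) auto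
      from saturatedD(2)[OF sat this] nz have
        "(\<lambda>t. (t, y)) ` {c<..<d} \<inter> G \<noteq> {} \<Longrightarrow> (\<lambda>t. (t, y)) ` {c<..<d} \<subseteq> G" by blast
      then show ?thesis unfolding A_def by blast
    qed
    have "k * integral {0..1} (\<lambda>t. (if t \<in> A then v (t, y) else 0)\<^sup>2)
        \<le> - integral {0..1} (\<lambda>t. (if t \<in> A then v (t, y) else 0) * vxx (t, y))"
    proof (rule wirtinger_periodic[where f'="\<lambda>t. vx (t, y)"])
      show "continuous_on UNIV (\<lambda>t. if t \<in> A then v (t, y) else 0)"
        using sl[OF g, of y] by (simp add: g_def A_def)
      show "k * (d - c)\<^sup>2 \<le> pi\<^sup>2" if "c < d" "{c<..<d} \<subseteq> A" for c d
        using that bd unfolding horizontal_bound_def A_def by blast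
    qed (use vx vxx sl[OF cont(2)] per sA bd[unfolded horizontal_bound_def] fin[of y] in
        \<open>auto simp: periodic2_def periodic_set_def A_def finite_zeros_def\<close>)
    then show ?thesis by (simp add: g_def A_def)
  qed
  have c2: "continuous_on (cbox (a, c) (b, d)) (\<lambda>p. (g p)\<^sup>2)" "continuous_on (cbox (a, c) (b, d)) (\<lambda>p. g p * vxx p)"
    for a b c d
    by (intro continuous_intros continuous_on_subset[OF g] continuous_on_subset[OF cont(2)] subset_UNIV)+
  have iter: "integral (cbox (0, 0) (1, 1)) h = integral {0..1} (\<lambda>y. integral {0..1} (\<lambda>x. h (x, y)))"
     and intg: "(\<lambda>y. integral {0..1} (\<lambda>x. h (x, y))) integrable_on {0..1}"
    if h: "continuous_on UNIV h" for h :: "real \<times> real \<Rightarrow> real"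
  proof -
    have "continuous_on (cbox (0, 0) (1::real, 1::real)) h" using h continuous_on_subset by blast
    from integral_prod_continuous[OF this] integral_swap_continuous[of 0 0 1 1 "\<lambda>x y. h (x, y)"] this
    show "integral (cbox (0, 0) (1, 1)) h = integral {0..1} (\<lambda>y. integral {0..1} (\<lambda>x. h (x, y)))"
      by simp
    have "continuous_on (cbox 0 1) (\<lambda>y::real. integral (cbox 0 1) (\<lambda>x::real. h (x, y)))"
      by (rule integral_continuous_on_param)
        (auto intro!: continuous_on_compose2[OF h] continuous_intros simp: split_def)
    then show "(\<lambda>y. integral {0..1} (\<lambda>x. h (x, y))) integrable_on {0..1}"
      using integrable_continuous by fastforce
  qed
  have cg: "continuous_on UNIV (\<lambda>p. (g p)\<^sup>2)" "continuous_on UNIV (\<lambda>p. g p * vxx p)"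
    by (intro continuous_intros g cont)+
  have "integral {0..1} (\<lambda>y. k * integral {0..1} (\<lambda>x. (g (x, y))\<^sup>2))
      \<le> integral {0..1} (\<lambda>y. - integral {0..1} (\<lambda>x. g (x, y) * vxx (x, y)))"
    by (intro integral_le line integrable_on_mult_right integrable_neg
       intg[OF cg(1)] intg[OF cg(2)] | simp)+
  then show ?thesis unfolding iter[OF cg(1)] iter[OF cg(2)] by simp
qed

section \<open>Exchange of the coordinates and the two-dimensional energy bound\<close>

lemma integral_unit_square_swap:
  fixes h :: "real \<times> real \<Rightarrow> real"
  assumes h: "continuous_on UNIV h"
  shows "integral (cbox (0, 0) (1, 1)) (\<lambda>p. h (prod.swap p)) = integral (cbox (0, 0) (1, 1)) h"
proof -
  have hs: "continuous_on UNIV (\<lambda>p. h (prod.swap p))"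
    unfolding prod.swap_def by (rule continuous_on_compose2[OF h]) (auto intro!: continuous_intros)
  have c: "continuous_on (cbox (0, 0) (1::real, 1::real)) h"
    "continuous_on (cbox (0, 0) (1::real, 1::real)) (\<lambda>p. h (prod.swap p))"
    using h hs continuous_on_subset by blast+
  show ?thesis
    using integral_prod_continuous[OF c(1)] integral_prod_continuous[OF c(2)]
      integral_swap_continuous[of 0 0 1 1 "\<lambda>x y. h (x, y)"] c(1)
    by simp
qed

lemma periodic2_of_int:
  assumes "periodic2 u"
  shows "u (x + of_int m, y + of_int n) = u (x, y)"
proof -
  have 1: "u (a + real k, b) = u (a, b)" "u (a, b + real k) = u (a, b)" for a b k
    using assms by (induction k) (auto simp: periodic2_def add.commute[of 1] simp flip: add.assoc)
  have 2: "u (a + of_int k, b) = u (a, b)" "u (a, b + of_int k) = u (a, b)" for a b k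
    using 1(1)[of a "nat k" b] 1(1)[of "a + of_int k" "nat (- k)" b]
      1(2)[of a b "nat k"] 1(2)[of a "b + of_int k" "nat (- k)"] by (cases "k \<ge> 0"; simp)+
  show ?thesis by (simp add: 2)
qed

lemma periodic2_square_integral_zero:
  assumes per: "periodic2 u" and u: "continuous_on UNIV u"
    and zero: "integral (cbox (0, 0) (1, 1)) (\<lambda>p. (u p)\<^sup>2) = 0"
  shows "u p = 0"
proof -
  let ?Q = "cbox (0, 0) (1, 1) :: (real \<times> real) set"
  have c: "continuous_on ?Q (\<lambda>p. (u p)\<^sup>2)"
    by (intro continuous_intros continuous_on_subset[OF u] subset_UNIV)
  then have h0: "((\<lambda>p. (u p)\<^sup>2) has_integral 0) ?Q"
    using integrable_integral[OF integrable_continuous[OF c]] zero by simp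
  obtain x y where xy: "p = (x, y)" by fastforce
  let ?q = "(frac x, frac y)"
  have "(u ?q)\<^sup>2 = 0"
    by (rule has_integral_0_cbox_imp_0[OF c _ h0])
      (auto simp: box_ne_empty Basis_prod_def frac_ge_0 frac_lt_1 less_imp_le)
  moreover have "u ?q = u p"
    using periodic2_of_int[OF per, of x "- \<lfloor>x\<rfloor>" y "- \<lfloor>y\<rfloor>"] by (simp add: frac_def xy)
  ultimately show ?thesis by simp
qed

lemma periodic2_partial:
  assumes per: "periodic2 u" and dx: "\<And>x y. ((\<lambda>t. u (t, y)) has_real_derivative ux (x, y)) (at x)"
  shows "periodic2 ux"
  unfolding periodic2_def
proof (intro allI conjI)
  fix x y :: real
  have "((\<lambda>t. u (t + 1, y)) has_real_derivative ux (x + 1, y)) (at x)"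
    using dx[of y "x + 1"] DERIV_shift[of "\<lambda>t. u (t, y)" "ux (x + 1, y)" x 1] by simp
  then show "ux (x + 1, y) = ux (x, y)"
    using per dx[of y x] by (auto simp: periodic2_def intro: DERIV_unique)
  show "ux (x, y + 1) = ux (x, y)"
    using per dx[of "y + 1" x] dx[of y x] by (auto simp: periodic2_def intro: DERIV_unique)
qed

lemma periodic2_swap: "periodic2 (\<lambda>p. u (prod.swap p)) = periodic2 u"
  by (auto simp: periodic2_def)

lemma periodic_set_swap: "periodic_set (prod.swap -` G) = periodic_set G"
  by (auto simp: periodic_set_def)

lemma continuous_on_swap_iff:
  fixes h :: "real \<times> real \<Rightarrow> real"
  shows "continuous_on UNIV (\<lambda>p. h (prod.swap p)) = continuous_on UNIV h"
proof -
  have *: "continuous_on UNIV (\<lambda>p. h (prod.swap p))" if "continuous_on UNIV h" for h :: "real \<times> real \<Rightarrow> real"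
    unfolding prod.swap_def by (rule continuous_on_compose2[OF that]) (auto intro!: continuous_intros)
  show ?thesis using *[of h] *[of "\<lambda>p. h (prod.swap p)"] by auto
qed

lemma saturated_swap:
  fixes v :: "real \<times> real \<Rightarrow> real"
  assumes "saturated v G"
  shows "saturated (\<lambda>p. v (prod.swap p)) (prod.swap -` G)"
  unfolding saturated_def
proof (intro conjI allI impI)
  show "prod.swap -` G \<subseteq> {p. v (prod.swap p) \<noteq> 0}" using saturatedD(1)[OF assms] by auto
  fix S :: "(real \<times> real) set" assume S: "connected S \<and> S \<subseteq> {p. v (prod.swap p) \<noteq> 0} \<and> S \<inter> prod.swap -` G \<noteq> {}"
  then have "connected (prod.swap ` S)"
    unfolding prod.swap_def by (intro connected_continuous_image continuous_intros) auto
  from saturatedD(2)[OF assms this] S have "prod.swap ` S \<subseteq> G" by blast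
  then show "S \<subseteq> prod.swap -` G" by blast
qed

text \<open>Testing the equation against the cutoff \<open>g\<close> gives \<open>lam\<close> times
  the integral of g^2, and the slice inequalities in both directions bound this from below by
  \<open>kx + ky\<close> times the same integral, which is positive as \<open>G\<close> is nonempty.
  The vertical inequality is the horizontal one with the coordinates exchanged.\<close>

lemma energy_bound:
  assumes sol: "solves_helmholtz lam v" and sat: "saturated v G" and per: "periodic_set G"
    and ne: "G \<noteq> {}"
    and bd: "horizontal_bound G kx" "horizontal_bound (prod.swap -` G) ky"
    and fin: "\<And>y. finite_zeros (\<lambda>t. v (t, y))" "\<And>x. finite_zeros (\<lambda>t. v (x, t))"
  shows "kx + ky \<le> lam"
proof -
  obtain ux uy uxx uyy where c: "continuous_on UNIV uxx" "continuous_on UNIV uyy" and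
     u: "\<And>x y. ((\<lambda>t. v (t, y)) has_real_derivative ux (x, y)) (at x)"
        "\<And>x y. ((\<lambda>t. ux (t, y)) has_real_derivative uxx (x, y)) (at x)"
        "\<And>x y. ((\<lambda>t. v (x, t)) has_real_derivative uy (x, y)) (at y)"
        "\<And>x y. ((\<lambda>t. uy (x, t)) has_real_derivative uyy (x, y)) (at y)"
     and eq: "\<And>p. - (uxx p + uyy p) = lam * v p" and p: "periodic2 v" and cv: "continuous_on UNIV v"
    using sol unfolding solves_helmholtz_def by blast
  have px: "periodic2 ux" "periodic2 uxx"
    using periodic2_partial[OF p u(1)] periodic2_partial[OF _ u(2)] by blast+
  have py': "periodic2 (\<lambda>p. uy (prod.swap p))"
    by (rule periodic2_partial[of "\<lambda>p. v (prod.swap p)"]) (use p u in \<open>auto simp: periodic2_swap\<close>)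
  have py: "periodic2 (\<lambda>p. uyy (prod.swap p))"
    by (rule periodic2_partial[OF py']) (use u in auto)
  define g where "g = (\<lambda>p. if p \<in> G then v p else 0)"
  have g: "continuous_on UNIV g" unfolding g_def by (rule saturated_cutoff_continuous[OF cv sat])
  let ?Q = "cbox (0, 0) (1, 1) :: (real \<times> real) set"
  have gi: "continuous_on UNIV (\<lambda>p. (g p)\<^sup>2)" "continuous_on UNIV (\<lambda>p. g p * uxx p)" "continuous_on UNIV (\<lambda>p. g p * uyy p)"
    by (intro continuous_intros g c)+
  have int: "h integrable_on ?Q" if "continuous_on UNIV h" for h :: "real \<times> real \<Rightarrow> real"
    using that continuous_on_subset integrable_continuous by blast
  have ex: "kx * integral ?Q (\<lambda>p. (g p)\<^sup>2) \<le> - integral ?Q (\<lambda>p. g p * uxx p)"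
    unfolding g_def by (rule horizontal_energy[OF p px per cv c(1) u(1,2) sat bd(1) fin(1)])
  have "ky * integral ?Q (\<lambda>p. (g (prod.swap p))\<^sup>2) \<le> - integral ?Q (\<lambda>p. g (prod.swap p) * uyy (prod.swap p))"
    using horizontal_energy[OF _ py' py _ _ _ _ _ saturated_swap[OF sat] bd(2)] p per cv c(2) u(3,4) fin(2)
    by (simp add: periodic2_swap periodic_set_swap continuous_on_swap_iff g_def)
  then have ey: "ky * integral ?Q (\<lambda>p. (g p)\<^sup>2) \<le> - integral ?Q (\<lambda>p. g p * uyy p)"
    using integral_unit_square_swap[OF gi(1)] integral_unit_square_swap[OF gi(3)] by simp
  have "g p * uxx p + g p * uyy p = - (lam * (g p)\<^sup>2)" for p
  proof -
    have "g p * uxx p + g p * uyy p = - (g p * (- (uxx p + uyy p)))" by (simp add: algebra_simps)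
    then show ?thesis unfolding eq by (simp add: g_def power2_eq_square)
  qed
  then have "integral ?Q (\<lambda>p. g p * uxx p) + integral ?Q (\<lambda>p. g p * uyy p) = - (lam * integral ?Q (\<lambda>p. (g p)\<^sup>2))"
    using int[OF gi(2)] int[OF gi(3)] by (simp flip: integral_add integral_mult_right)
  with ex ey have le: "(kx + ky) * integral ?Q (\<lambda>p. (g p)\<^sup>2) \<le> lam * integral ?Q (\<lambda>p. (g p)\<^sup>2)"
    by (simp add: algebra_simps)
  have "periodic2 g" using p per by (auto simp: periodic2_def periodic_set_def g_def)
  moreover obtain q where "q \<in> G" using ne by blast
  then have "g q \<noteq> 0" using saturatedD(1)[OF sat] by (simp add: g_def)
  moreover have "integral ?Q (\<lambda>p. (g p)\<^sup>2) \<ge> 0" by (rule integral_nonneg[OF int[OF gi(1)]]) simp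
  ultimately have pos: "integral ?Q (\<lambda>p. (g p)\<^sup>2) > 0"
    using periodic2_square_integral_zero[OF _ g] by fastforce
  show ?thesis using le pos by simp
qed

section \<open>Counting saturated sets along lines\<close>

text \<open>Following a point of \<open>A i\<close> to the right up to the next zero assigns to each
  set a zero modulo 1, and distinct sets get distinct zeros. Without zeros a set is the whole line,
  so there is at most one; hence the condition \<open>1 \<le> m\<close>.\<close>

lemma card_saturated_le_zeros:
  fixes f :: "real \<Rightarrow> real"
  assumes cont: "continuous_on UNIV f" and per: "\<And>t. f (t + 1) = f t"
    and J: "finite J" and sat: "\<And>i. i \<in> J \<Longrightarrow> saturated f (A i)" and ne: "\<And>i. i \<in> J \<Longrightarrow> A i \<noteq> {}"
    and disj: "\<And>i j. i \<in> J \<Longrightarrow> j \<in> J \<Longrightarrow> i \<noteq> j \<Longrightarrow> A i \<inter> A j = {}"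
    and perA: "\<And>i t. i \<in> J \<Longrightarrow> t + 1 \<in> A i \<longleftrightarrow> t \<in> A i"
    and fin: "finite {t \<in> {0..<1}. f t = 0}" and m: "card {t \<in> {0..<1}. f t = 0} \<le> m" "1 \<le> m"
  shows "card J \<le> m"
proof (cases "\<exists>z. f z = 0")
  case False
  have "A i = UNIV" if "i \<in> J" for i
    using saturatedD(2)[OF sat[OF that], of UNIV] ne[OF that] False by auto
  then have "i = j" if "i \<in> J" "j \<in> J" for i j using disj that by blast
  then have "card J \<le> 1" using card_le_Suc0_iff_eq[OF J] by simp
  then show ?thesis using m by simp
next
  case True
  then obtain z0 where z0: "f z0 = 0" by blast
  have pnat: "f (t + real k) = f t" "i \<in> J \<Longrightarrow> t + real k \<in> A i \<longleftrightarrow> t \<in> A i" for t k i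
    by (induction k) (auto simp: add.commute[of 1] per perA simp flip: add.assoc)
  have pint: "f (t + of_int k) = f t" "i \<in> J \<Longrightarrow> t + of_int k \<in> A i \<longleftrightarrow> t \<in> A i" for t k i
    using pnat(1)[of t "nat k"] pnat(1)[of "t + of_int k" "nat (- k)"]
      pnat(2)[of i t "nat k"] pnat(2)[of i "t + of_int k" "nat (- k)"] by (cases "k \<ge> 0"; simp)+
  have next_zero: "\<exists>z>t. f z = 0 \<and> (\<forall>s\<in>{t..<z}. f s \<noteq> 0)" if "f t \<noteq> 0" for t
  proof -
    define Z where "Z = {z. t \<le> z \<and> f z = 0}"
    have "z0 + of_int \<lceil>t - z0\<rceil> \<in> Z" unfolding Z_def using z0 pint(1) by simp linarith
    then have Zne: "Z \<noteq> {}" by blast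
    have bdd: "bdd_below Z" unfolding Z_def by (auto intro: bdd_belowI)
    have "closed ({t..} \<inter> f -` {0})"
      by (intro closed_Int closed_atLeast continuous_closed_vimage closed_singleton)
        (use cont in \<open>simp add: continuous_on_eq_continuous_at\<close>)
    then have "closed Z" by (auto simp: Z_def Int_def vimage_def)
    then have "Inf Z \<in> Z" using closed_contains_Inf[OF Zne bdd] by simp
    then have z: "t \<le> Inf Z" "f (Inf Z) = 0" by (simp_all add: Z_def)
    have "f s \<noteq> 0" if s: "s \<in> {t..<Inf Z}" for s
    proof
      assume "f s = 0"
      then have "s \<in> Z" using s by (simp add: Z_def)
      from cInf_lower[OF this bdd] s show False by simp
    qed
    moreover have "t \<noteq> Inf Z" using z that by metis
    ultimately show ?thesis using z by (intro exI[of _ "Inf Z"]) simp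
  qed
  have "\<forall>i\<in>J. \<exists>p. fst p \<in> A i \<and> fst p < snd p \<and> f (snd p) = 0 \<and> (\<forall>s\<in>{fst p..<snd p}. f s \<noteq> 0)"
  proof
    fix i assume i: "i \<in> J"
    then obtain t where t: "t \<in> A i" using ne by blast
    then obtain z where "z > t" "f z = 0" "\<forall>s\<in>{t..<z}. f s \<noteq> 0"
      using next_zero saturatedD(1)[OF sat[OF i]] by blast
    then show "\<exists>p. fst p \<in> A i \<and> fst p < snd p \<and> f (snd p) = 0 \<and> (\<forall>s\<in>{fst p..<snd p}. f s \<noteq> 0)"
      using t by (intro exI[of _ "(t, z)"]) simp
  qed
  from bchoice[OF this] obtain p where p: "\<forall>i\<in>J. fst (p i) \<in> A i \<and> fst (p i) < snd (p i) \<and>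
      f (snd (p i)) = 0 \<and> (\<forall>s\<in>{fst (p i)..<snd (p i)}. f s \<noteq> 0)" ..
  define T Z where "T = (\<lambda>i. fst (p i))" and "Z = (\<lambda>i. snd (p i))"
  have TZ: "T i \<in> A i \<and> T i < Z i \<and> f (Z i) = 0 \<and> (\<forall>s\<in>{T i..<Z i}. f s \<noteq> 0)" if "i \<in> J" for i
    using p that by (auto simp: T_def Z_def)
  have "inj_on (\<lambda>i. frac (Z i)) J"
  proof (rule inj_onI, rule ccontr)
    fix i j assume ij: "i \<in> J" "j \<in> J" "frac (Z i) = frac (Z j)" "i \<noteq> j"
    define k where "k = \<lfloor>Z i\<rfloor> - \<lfloor>Z j\<rfloor>"
    have Zk: "Z i = Z j + of_int k" using ij(3) by (simp add: k_def frac_def)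
    \<comment> \<open>After translation by \<open>k\<close> both stretches end at the same zero, so
      their union is an interval without zeros that meets both sets.\<close>
    define S where "S = {min (T i) (T j + of_int k)..<Z i}"
    have nz: "f s \<noteq> 0" if "s \<in> S" for s
    proof (cases "T i \<le> s")
      case True
      then show ?thesis using that TZ[OF ij(1)] by (simp add: S_def)
    next
      case False
      then have "s - of_int k \<in> {T j..<Z j}" using that Zk by (auto simp: S_def)
      then show ?thesis using TZ[OF ij(2)] pint(1)[of "s - of_int k" k] by auto
    qed
    have "T j + of_int k \<in> A j" using TZ[OF ij(2)] pint(2)[OF ij(2)] by simp
    moreover have "T i \<in> S" "T j + of_int k \<in> S" using TZ[OF ij(1)] TZ[OF ij(2)] Zk by (auto simp: S_def)
    moreover have "connected S" unfolding S_def by simp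
    ultimately have "S \<subseteq> A i" "S \<subseteq> A j"
      using TZ[OF ij(1)] by (intro saturatedD(2)[OF sat] ij nz; blast)+
    then show False using disj[OF ij(1,2,4)] \<open>T i \<in> S\<close> by blast
  qed
  moreover have "(\<lambda>i. frac (Z i)) ` J \<subseteq> {t \<in> {0..<1}. f t = 0}"
    using TZ pint(1)[of "Z _" "- \<lfloor>Z _\<rfloor>"] by (auto simp: frac_ge_0 frac_lt_1) (simp add: frac_def)
  ultimately have "card J \<le> card {t \<in> {0..<1}. f t = 0}" using fin by (rule card_inj_on_le)
  then show ?thesis using m by simp
qed

section \<open>Widths and heights of a family of disjoint saturated sets\<close>

text \<open>Double counting: the total length is the integral over one period of the number of
  intervals that cover \<open>x\<close> modulo \<open>P\<close>. As the intervals start in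
  \<open>[0, P]\<close>, they lie in \<open>[0, 2 P]\<close>, which is folded onto
  \<open>[0, P]\<close>.\<close>

lemma sum_lengths_le:
  fixes a b :: "'i \<Rightarrow> real"
  assumes I: "finite I" and P: "0 < P"
    and ab: "\<And>i. i \<in> I \<Longrightarrow> 0 \<le> a i \<and> a i \<le> b i \<and> b i \<le> a i + P \<and> a i \<le> P"
    and m: "\<And>x. x \<in> {0..P} \<Longrightarrow> card {i \<in> I. x \<in> {a i<..<b i} \<or> x + P \<in> {a i<..<b i}} \<le> m"
  shows "(\<Sum>i\<in>I. b i - a i) \<le> real m * P"
proof -
  define S where "S = (\<lambda>x. \<Sum>i\<in>I. if x \<in> {a i<..<b i} then 1 else 0 :: real)"
  have S: "(S has_integral (\<Sum>i\<in>I. b i - a i)) {0..2 * P}"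
    unfolding S_def
  proof (rule has_integral_sum[OF I])
    fix i assume i: "i \<in> I"
    have "((\<lambda>x. 1::real) has_integral (b i - a i)) {a i..b i}"
      using has_integral_const_real[of "1::real" "a i" "b i"] ab[OF i] by simp
    then have "((\<lambda>x. 1::real) has_integral (b i - a i)) {a i<..<b i}"
      by (simp add: has_integral_Icc_iff_Ioo)
    moreover have "{a i<..<b i} \<subseteq> {0..2 * P}" using ab[OF i] by auto
    ultimately show "((\<lambda>x. if x \<in> {a i<..<b i} then 1 else 0 :: real) has_integral (b i - a i)) {0..2 * P}"
      by (subst has_integral_restrict)
  qed
  then have int: "S integrable_on {0..2 * P}" by blast
  have i1: "S integrable_on {0..P}" and i2: "S integrable_on {P..2 * P}"
    by (rule integrable_on_subinterval[OF int]; use P in auto)+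
  have "(S has_integral integral {P..2 * P} S) (cbox P (2 * P))" using i2 by auto
  from has_integral_affinity'[OF this, of 1 P]
  have sh: "((\<lambda>x. S (x + P)) has_integral integral {P..2 * P} S) {0..P}" by (simp add: box_real)
  have "((\<lambda>x. S x + S (x + P)) has_integral (integral {0..P} S + integral {P..2 * P} S)) {0..P}"
    by (intro has_integral_add sh integrable_integral i1)
  also have "integral {0..P} S + integral {P..2 * P} S = integral {0..2 * P} S"
    by (rule Henstock_Kurzweil_Integration.integral_combine) (use P int in auto)
  also have "\<dots> = (\<Sum>i\<in>I. b i - a i)" using S by (rule integral_unique)
  finally have hi: "((\<lambda>x. S x + S (x + P)) has_integral (\<Sum>i\<in>I. b i - a i)) {0..P}" .
  have "S x + S (x + P) \<le> real m" if "x \<in> {0..P}" for x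
  proof -
    have "S x + S (x + P) = (\<Sum>i\<in>I. (if x \<in> {a i<..<b i} then 1 else 0) + (if x + P \<in> {a i<..<b i} then 1 else 0))"
      by (simp add: S_def sum.distrib)
    \<comment> \<open>An open interval of length at most \<open>P\<close> cannot contain both
      \<open>x\<close> and \<open>x + P\<close>, so the two indicators never add up to 2.\<close>
    also have "\<dots> = (\<Sum>i\<in>I. if x \<in> {a i<..<b i} \<or> x + P \<in> {a i<..<b i} then 1 else 0)"
      by (rule sum.cong) (use ab P in fastforce)+
    also have "\<dots> = real (card {i \<in> I. x \<in> {a i<..<b i} \<or> x + P \<in> {a i<..<b i}})"
      using I by (simp add: sum.If_cases Int_def)
    also have "\<dots> \<le> real m" using m[OF that] by simp
    finally show ?thesis .
  qed
  moreover have "((\<lambda>x. real m) has_integral real m * P) {0..P}"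
    using has_integral_const_real[of "real m" 0 P] P by (simp add: mult.commute)
  ultimately show ?thesis using has_integral_le[OF hi] by blast
qed

lemma open_horizontal_segment:
  fixes G :: "(real \<times> real) set"
  assumes "open G" "(x, y) \<in> G"
  obtains r where "r > 0" "\<And>t. \<bar>t - x\<bar> < r \<Longrightarrow> (t, y) \<in> G"
proof -
  obtain r where r: "r > 0" "ball (x, y) r \<subseteq> G" using assms unfolding open_contains_ball by blast
  have "(t, y) \<in> G" if "\<bar>t - x\<bar> < r" for t
    using r(2) that by (auto simp: subset_iff dist_Pair_Pair dist_real_def abs_minus_commute)
  with r(1) show ?thesis using that by blast
qed

text \<open>W i is the supremum of the lengths of the horizontal segments in G i, capped at P; the last
  bound is the tangent line at w of the convex function 1/W^2. If the cap is active, then k i = 0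
  and the tangent line is already negative.\<close>
lemma horizontal_widths:
  fixes v :: "real \<times> real \<Rightarrow> real" and G :: "'i \<Rightarrow> (real \<times> real) set"
  assumes v: "continuous_on UNIV v" "periodic2 v"
    and I: "finite I" and sat: "\<And>i. i \<in> I \<Longrightarrow> saturated v (G i)" and ne: "\<And>i. i \<in> I \<Longrightarrow> G i \<noteq> {}"
    and disj: "\<And>i j. i \<in> I \<Longrightarrow> j \<in> I \<Longrightarrow> i \<noteq> j \<Longrightarrow> G i \<inter> G j = {}"
    and per: "\<And>i. i \<in> I \<Longrightarrow> periodic_set (G i)"
    and P: "0 < P" and shift: "\<And>i x y. i \<in> I \<Longrightarrow> (x + P, y + \<tau>) \<in> G i \<longleftrightarrow> (x, y) \<in> G i"
    and zeros: "\<And>x. (\<forall>t. v (x, t) = 0) \<or> finite {t \<in> {0..<1}. v (x, t) = 0} \<and> card {t \<in> {0..<1}. v (x, t) = 0} \<le> m"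
    and m: "1 \<le> m" and w: "0 < w" "3 * w \<le> 2 * P"
  obtains k W where "\<And>i. i \<in> I \<Longrightarrow> horizontal_bound (G i) (pi\<^sup>2 * k i)"
    and "\<And>i. i \<in> I \<Longrightarrow> 3 / w ^ 2 - 2 * W i / w ^ 3 \<le> k i"
    and "(\<Sum>i\<in>I. W i) \<le> real m * P"
proof -
  define seg where "seg = (\<lambda>i c y l. (\<lambda>t. (t, y)) ` {c<..<c + l} \<subseteq> G i)"
  define Ls where "Ls = (\<lambda>i. {l. 0 < l \<and> l \<le> P \<and> (\<exists>c y. seg i c y l)})"
  define W where "W = (\<lambda>i. Sup (Ls i))"
  define k where "k = (\<lambda>i. if W i = P then 0 else 1 / (W i)\<^sup>2)"
  have bdd: "bdd_above (Ls i)" for i unfolding Ls_def by (rule bdd_aboveI[of _ P]) auto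
  have Lne: "Ls i \<noteq> {}" if i: "i \<in> I" for i
  proof -
    obtain x y where xy: "(x, y) \<in> G i" using ne[OF i] by auto
    obtain r where r: "r > 0" "\<And>t. \<bar>t - x\<bar> < r \<Longrightarrow> (t, y) \<in> G i"
      using open_horizontal_segment[OF saturated_open[OF v(1) sat[OF i]] xy] by blast
    have "seg i x y (min r P)" unfolding seg_def using r by auto
    then have "min r P \<in> Ls i" using r P by (auto simp: Ls_def)
    then show ?thesis by blast
  qed
  have W: "0 < W i" "W i \<le> P" if i: "i \<in> I" for i
  proof -
    obtain l where l: "l \<in> Ls i" using Lne[OF i] by blast
    from cSup_upper[OF l bdd] l show "0 < W i" by (auto simp: W_def Ls_def)
    show "W i \<le> P" unfolding W_def by (rule cSup_least[OF Lne[OF i]]) (auto simp: Ls_def)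
  qed
  have "horizontal_bound (G i) (pi\<^sup>2 * k i)" if i: "i \<in> I" for i
  proof (cases "W i = P")
    case True
    then show ?thesis by (simp add: k_def horizontal_bound_def)
  next
    case False
    then have lt: "W i < P" using W[OF i] by simp
    have "(d - c)\<^sup>2 \<le> (W i)\<^sup>2" if cd: "c < d" "(\<lambda>t. (t, y)) ` {c<..<d} \<subseteq> G i" for y c d
    proof -
      have "{c<..<c + min (d - c) P} \<subseteq> {c<..<d}" by auto
      then have "seg i c y (min (d - c) P)" using cd(2) unfolding seg_def by blast
      then have "min (d - c) P \<in> Ls i" using cd P by (auto simp: Ls_def)
      from cSup_upper[OF this bdd] lt have "d - c \<le> W i" by (auto simp: W_def min_def split: if_splits)
      then show ?thesis using cd by (intro power_mono) auto
    qed
    then show ?thesis using W[OF i] False by (auto simp: horizontal_bound_def k_def divide_simps)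
  qed
  moreover have "3 / w ^ 2 - 2 * W i / w ^ 3 \<le> k i" if i: "i \<in> I" for i
  proof (cases "W i = P")
    case True
    then have "3 / w ^ 2 - 2 * W i / w ^ 3 = (3 * w - 2 * P) / w ^ 3"
      using w by (simp add: field_simps power2_eq_square power3_eq_cube)
    also have "\<dots> \<le> 0" using w by (simp add: divide_nonpos_pos)
    finally show ?thesis using True by (simp add: k_def)
  next
    case False
    \<comment> \<open>The product equals w^3 - 3 w W^2 + 2 W^3, so this is the tangent inequality
      cleared of denominators; the double root at W = w is the point of contact.\<close>
    have "0 \<le> (w - W i)\<^sup>2 * (w + 2 * W i)" using w W[OF i] by simp
    then have "3 * w * (W i)\<^sup>2 - 2 * W i ^ 3 \<le> w ^ 3"
      by (simp add: algebra_simps power2_eq_square power3_eq_cube)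
    moreover have "3 / w ^ 2 - 2 * W i / w ^ 3 = (3 * w * (W i)\<^sup>2 - 2 * W i ^ 3) / (w ^ 3 * (W i)\<^sup>2)"
      using w W[OF i] by (simp add: field_simps power2_eq_square power3_eq_cube)
    moreover have "1 / (W i)\<^sup>2 = w ^ 3 / (w ^ 3 * (W i)\<^sup>2)" using w by simp
    moreover have "(3 * w * (W i)\<^sup>2 - 2 * W i ^ 3) / (w ^ 3 * (W i)\<^sup>2) \<le> w ^ 3 / (w ^ 3 * (W i)\<^sup>2)"
      using calculation(1) w by (intro divide_right_mono) auto
    ultimately have "3 / w ^ 2 - 2 * W i / w ^ 3 \<le> 1 / (W i)\<^sup>2" by linarith
    then show ?thesis using False by (simp add: k_def)
  qed
  moreover have "(\<Sum>i\<in>I. W i) \<le> real m * P"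
  proof (rule field_le_epsilon)
    fix e :: real assume e: "0 < e"
    \<comment> \<open>The suprema need not be attained; each is approached up to
      \<open>\<delta>\<close>, at a total cost below \<open>e\<close>.\<close>
    define \<delta> where "\<delta> = e / (real (card I) + 1)"
    have \<delta>: "\<delta> > 0" using e by (simp add: \<delta>_def)
    have "\<exists>c y l. 0 \<le> c \<and> c \<le> P \<and> 0 < l \<and> l \<le> P \<and> W i - \<delta> < l \<and> seg i c y l" if i: "i \<in> I" for i
    proof -
      have "W i - \<delta> < Sup (Ls i)" using \<delta> by (simp add: W_def)
      then obtain l where l: "l \<in> Ls i" "W i - \<delta> < l" using less_cSup_iff[OF Lne[OF i] bdd] by blast
      then obtain c y where s: "seg i c y l" by (auto simp: Ls_def)
      \<comment> \<open>A multiple of the vector \<open>(P, \<tau>)\<close> moves the start of the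
        segment into \<open>[0, P]\<close>. The change of height is harmless, since only projections
        to the horizontal axis are compared below.\<close>
      define j where "j = \<lfloor>c / P\<rfloor>"
      have sn: "(x + real n * P, y + real n * \<tau>) \<in> G i \<longleftrightarrow> (x, y) \<in> G i" for n x y
      proof (induction n)
        case (Suc n)
        then show ?case using shift[OF i, of "x + real n * P" "y + real n * \<tau>"] by (simp add: algebra_simps)
      qed simp
      have sj: "(x + of_int n * P, y + of_int n * \<tau>) \<in> G i \<longleftrightarrow> (x, y) \<in> G i" for n x y
        using sn[where n="nat n"] sn[where n="nat (- n)" and x="x + of_int n * P" and y="y + of_int n * \<tau>"]
        by (cases "n \<ge> 0") auto
      have "seg i (c - of_int j * P) (y - of_int j * \<tau>) l"
        unfolding seg_def
      proof (clarify)
        fix t assume t: "t \<in> {c - of_int j * P<..<c - of_int j * P + l}"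
        then have "(t + of_int j * P, y) \<in> G i" using s by (auto simp: seg_def image_subset_iff)
        then show "(t, y - of_int j * \<tau>) \<in> G i" using sj[of t j "y - of_int j * \<tau>"] by simp
      qed
      moreover have "of_int j * P \<le> c" "c \<le> of_int j * P + P"
        using P floor_divide_lower[OF P, of c] floor_divide_upper[OF P, of c] by (auto simp: j_def algebra_simps)
      ultimately show ?thesis using l
        by (intro exI[of _ "c - of_int j * P"] exI[of _ "y - of_int j * \<tau>"] exI[of _ l]) (auto simp: Ls_def)
    qed
    then have "\<forall>i\<in>I. \<exists>p. case p of (c, y, l) \<Rightarrow> 0 \<le> c \<and> c \<le> P \<and> 0 < l \<and> l \<le> P \<and> W i - \<delta> < l \<and> seg i c y l"
      by fastforce
    from bchoice[OF this] obtain p where p: "\<forall>i\<in>I. case p i of (c, y, l) \<Rightarrow>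
        0 \<le> c \<and> c \<le> P \<and> 0 < l \<and> l \<le> P \<and> W i - \<delta> < l \<and> seg i c y l" ..
    define c y l where "c = (\<lambda>i. fst (p i))" and "y = (\<lambda>i. fst (snd (p i)))" and "l = (\<lambda>i. snd (snd (p i)))"
    have cyl: "0 \<le> c i" "c i \<le> P" "0 < l i" "l i \<le> P" "W i - \<delta> < l i" "seg i (c i) (y i) (l i)" if "i \<in> I" for i
      using p that by (auto simp: c_def y_def l_def split_def)
    \<comment> \<open>The segments lie at different heights, and only their projections matter: the
      vertical line over \<open>x\<close> meets every \<open>G i\<close> whose projected segment
      covers \<open>x\<close> or \<open>x + P\<close>, and a line meets at most \<open>m\<close> of
      these sets.\<close>
    have "(\<Sum>i\<in>I. (c i + l i) - c i) \<le> real m * P"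
    proof (rule sum_lengths_le[OF I P])
      fix x assume "x \<in> {0..P}"
      define J where "J = {i \<in> I. x \<in> {c i<..<c i + l i} \<or> x + P \<in> {c i<..<c i + l i}}"
      have JI: "J \<subseteq> I" by (auto simp: J_def)
      have "\<exists>t. (x, t) \<in> G i" if "i \<in> J" for i
      proof -
        have i: "i \<in> I" using that JI by blast
        have "(x, y i) \<in> G i \<or> (x + P, y i) \<in> G i"
          using that cyl(6)[OF i] by (auto simp: J_def seg_def image_subset_iff)
        then show ?thesis using shift[OF i, of x "y i - \<tau>"] by auto
      qed
      then have ex: "{t. (x, t) \<in> G i} \<noteq> {}" if "i \<in> J" for i using that by blast
      have "card J \<le> m"
      proof (cases "J = {}")
        case False
        show ?thesis
        proof (rule card_saturated_le_zeros[where f="\<lambda>t. v (x, t)" and A="\<lambda>i. {t. (x, t) \<in> G i}"])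
          show "continuous_on UNIV (\<lambda>t. v (x, t))"
            by (rule continuous_on_compose2[OF v(1)]) (auto intro!: continuous_intros)
          show "v (x, t + 1) = v (x, t)" for t using v(2) by (simp add: periodic2_def)
          show "finite J" using JI I by (rule finite_subset)
          show "saturated (\<lambda>t. v (x, t)) {t. (x, t) \<in> G i}" if "i \<in> J" for i
            unfolding saturated_def
          proof (intro conjI allI impI)
            have i: "saturated v (G i)" using sat that JI by blast
            show "{t. (x, t) \<in> G i} \<subseteq> {p. v (x, p) \<noteq> 0}" using saturatedD(1)[OF i] by blast
            fix S assume S: "connected S \<and> S \<subseteq> {p. v (x, p) \<noteq> 0} \<and> S \<inter> {t. (x, t) \<in> G i} \<noteq> {}"
            have "connected ((\<lambda>t. (x, t)) ` S)"
              using S by (intro connected_continuous_image continuous_intros) auto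
            from saturatedD(2)[OF i this] S show "S \<subseteq> {t. (x, t) \<in> G i}" by blast
          qed
          show "{t. (x, t) \<in> G i} \<inter> {t. (x, t) \<in> G j} = {}" if "i \<in> J" "j \<in> J" "i \<noteq> j" for i j
            using disj that JI by blast
          show "t + 1 \<in> {t. (x, t) \<in> G i} \<longleftrightarrow> t \<in> {t. (x, t) \<in> G i}" if "i \<in> J" for i t
            using per that JI by (auto simp: periodic_set_def)
          \<comment> \<open>The line meets some \<open>G i\<close>, so \<open>v\<close> is not
            identically zero on it, which excludes the first alternative in
            \<open>zeros\<close>.\<close>
          obtain i t where "i \<in> J" "(x, t) \<in> G i" using ex False by blast
          then have "v (x, t) \<noteq> 0" using saturatedD(1)[OF sat] JI by blast
          then show "finite {t \<in> {0..<1}. v (x, t) = 0}" "card {t \<in> {0..<1}. v (x, t) = 0} \<le> m"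
            using zeros[of x] by blast+
        qed (use ex m in auto)
      qed simp
      then show "card {i \<in> I. x \<in> {c i<..<c i + l i} \<or> x + P \<in> {c i<..<c i + l i}} \<le> m" by (simp add: J_def)
    qed (use cyl in \<open>auto simp: less_imp_le\<close>)
    moreover have "(\<Sum>i\<in>I. W i - \<delta>) \<le> (\<Sum>i\<in>I. (c i + l i) - c i)"
      by (rule sum_mono) (use cyl(5) in \<open>simp add: less_imp_le\<close>)
    moreover have "real (card I) * \<delta> \<le> e" using e by (simp add: \<delta>_def field_simps)
    ultimately show "(\<Sum>i\<in>I. W i) \<le> real m * P + e" by (simp add: sum_subtractf)
  qed
  ultimately show ?thesis by (rule that)
qed

lemma finite_zeros_periodic:
  assumes per: "\<And>t. f (t + 1) = f t" and z: "(\<forall>t. f t = 0) \<or> finite {t \<in> {0..<1::real}. f t = 0}"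
  shows "finite_zeros f"
proof (cases "\<forall>t. f t = 0")
  case True
  then show ?thesis by (simp add: finite_zeros_def)
next
  case False
  then have fin: "finite {t \<in> {0..<1}. f t = 0}" using z by blast
  have pnat: "f (t + real k) = f t" for t k
    by (induction k) (auto simp: add.commute[of 1] per simp flip: add.assoc)
  have pint: "f (t + of_int k) = f t" for t k
    using pnat[of t "nat k"] pnat[of "t + of_int k" "nat (- k)"] by (cases "k \<ge> 0"; simp)
  show ?thesis unfolding finite_zeros_def
  proof (intro disjI2 allI)
    fix a b :: real
    have "{t \<in> {a<..<b}. f t = 0} \<subseteq> (\<lambda>(s, k). s + of_int k) ` ({t \<in> {0..<1}. f t = 0} \<times> {\<lfloor>a\<rfloor>..\<lfloor>b\<rfloor>})"
    proof
      fix t assume t: "t \<in> {t \<in> {a<..<b}. f t = 0}"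
      have "frac t \<in> {t \<in> {0..<1}. f t = 0}"
        using t pint[of t "- \<lfloor>t\<rfloor>"] by (simp add: frac_def) linarith
      moreover have "\<lfloor>t\<rfloor> \<in> {\<lfloor>a\<rfloor>..\<lfloor>b\<rfloor>}" using t by (auto intro: floor_mono)
      ultimately show "t \<in> (\<lambda>(s, k). s + of_int k) ` ({t \<in> {0..<1}. f t = 0} \<times> {\<lfloor>a\<rfloor>..\<lfloor>b\<rfloor>})"
        by (intro image_eqI[of _ _ "(frac t, \<lfloor>t\<rfloor>)"]) (auto simp: frac_def)
    qed
    then show "finite {t \<in> {a<..<b}. f t = 0}" by (rule finite_subset) (use fin in auto)
  qed
qed

text \<open>Adds the tangent bounds over the family: with n = \<open>card I\<close>, widths and
  heights each sum to at most n w, which leaves n * 2 / w^2 \<le> 4 M n. The shift assumptions say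
  that a move by \<open>1 / K\<close> along one axis can be compensated along the other, so
  \<open>1 / K\<close> takes the place of the period 1.\<close>

lemma saturated_family_bound:
  fixes v :: "real \<times> real \<Rightarrow> real" and G :: "'i \<Rightarrow> (real \<times> real) set"
  assumes v: "solves_helmholtz (4 * pi\<^sup>2 * M) v"
    and I: "finite I" and sat: "\<And>i. i \<in> I \<Longrightarrow> saturated v (G i)" and ne: "\<And>i. i \<in> I \<Longrightarrow> G i \<noteq> {}"
    and disj: "\<And>i j. i \<in> I \<Longrightarrow> j \<in> I \<Longrightarrow> i \<noteq> j \<Longrightarrow> G i \<inter> G j = {}"
    and per: "\<And>i. i \<in> I \<Longrightarrow> periodic_set (G i)"
    and K: "0 < K"
    and shift1: "\<And>i x y. i \<in> I \<Longrightarrow> (x + 1 / K, y + \<sigma>) \<in> G i \<longleftrightarrow> (x, y) \<in> G i"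
    and shift2: "\<And>i x y. i \<in> I \<Longrightarrow> (x + \<tau>, y + 1 / K) \<in> G i \<longleftrightarrow> (x, y) \<in> G i"
    and zeros1: "\<And>x. (\<forall>t. v (x, t) = 0) \<or> finite {t \<in> {0..<1}. v (x, t) = 0} \<and> card {t \<in> {0..<1}. v (x, t) = 0} \<le> 2 * d"
    and zeros2: "\<And>y. (\<forall>t. v (t, y) = 0) \<or> finite {t \<in> {0..<1}. v (t, y) = 0} \<and> card {t \<in> {0..<1}. v (t, y) = 0} \<le> 2 * d"
    and d: "1 \<le> d" and n: "3 * d \<le> card I"
  shows "K\<^sup>2 * (real (card I))\<^sup>2 \<le> 8 * M * (real d)\<^sup>2"
proof -
  have vc: "continuous_on UNIV v" and vp: "periodic2 v" using v by (auto simp: solves_helmholtz_def)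
  define n where "n = real (card I)"
  have n0: "n > 0" "3 * real d \<le> n" using d n by (auto simp: n_def)
  \<comment> \<open>The upper bound for the mean width, which is the optimal point for the tangent.
    The condition 3 w \<le> 2 / K, which keeps the tangent nonpositive at the cap, is exactly
    \<open>3 * d \<le> n\<close>.\<close>
  define w where "w = 2 * real d / (K * n)"
  have w: "0 < w" "3 * w \<le> 2 * (1 / K)" using K n0 d by (auto simp: w_def field_simps)
  have m: "1 \<le> 2 * d" using d by simp
  have P: "0 < 1 / K" using K by simp
  obtain k1 W1 where W1: "\<And>i. i \<in> I \<Longrightarrow> horizontal_bound (G i) (pi\<^sup>2 * k1 i)"
    "\<And>i. i \<in> I \<Longrightarrow> 3 / w ^ 2 - 2 * W1 i / w ^ 3 \<le> k1 i" "(\<Sum>i\<in>I. W1 i) \<le> real (2 * d) * (1 / K)"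
    using horizontal_widths[of v I G "1 / K", OF vc vp I sat ne disj per P shift1 zeros1 m w] by blast
  obtain k2 W2 where W2: "\<And>i. i \<in> I \<Longrightarrow> horizontal_bound (prod.swap -` G i) (pi\<^sup>2 * k2 i)"
    "\<And>i. i \<in> I \<Longrightarrow> 3 / w ^ 2 - 2 * W2 i / w ^ 3 \<le> k2 i" "(\<Sum>i\<in>I. W2 i) \<le> real (2 * d) * (1 / K)"
  proof (rule horizontal_widths[of "\<lambda>p. v (prod.swap p)" I "\<lambda>i. prod.swap -` G i" "1 / K" \<tau> "2 * d" w])
    show "prod.swap -` G i \<noteq> {}" if i: "i \<in> I" for i
    proof -
      obtain x y where "(x, y) \<in> G i" using ne[OF i] by auto
      then have "(y, x) \<in> prod.swap -` G i" by simp
      then show ?thesis by blast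
    qed
    show "prod.swap -` G i \<inter> prod.swap -` G j = {}" if "i \<in> I" "j \<in> I" "i \<noteq> j" for i j
      using disj[OF that] by blast
  qed (use vc vp I saturated_swap sat per P shift2 zeros2 m w in
       \<open>auto simp: continuous_on_swap_iff periodic2_swap periodic_set_swap\<close>)
  have "2 * (3 / w ^ 2) - 2 * (W1 i + W2 i) / w ^ 3 \<le> 4 * M" if i: "i \<in> I" for i
  proof -
    have "pi\<^sup>2 * k1 i + pi\<^sup>2 * k2 i \<le> 4 * pi\<^sup>2 * M"
      using zeros1 zeros2 vp
      by (intro energy_bound[OF v sat[OF i] per[OF i] ne[OF i] W1(1)[OF i] W2(1)[OF i]] finite_zeros_periodic)
        (auto simp: periodic2_def)
    then have "pi\<^sup>2 * (k1 i + k2 i) \<le> pi\<^sup>2 * (4 * M)" by (simp add: algebra_simps)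
    then have "k1 i + k2 i \<le> 4 * M" by (simp add: mult_le_cancel_left)
    with W1(2)[OF i] W2(2)[OF i] show ?thesis by (simp add: algebra_simps add_divide_distrib)
  qed
  then have "(\<Sum>i\<in>I. 2 * (3 / w ^ 2) - 2 * (W1 i + W2 i) / w ^ 3) \<le> (\<Sum>i\<in>I. 4 * M)" by (rule sum_mono)
  then have "n * (6 / w ^ 2) - 2 * ((\<Sum>i\<in>I. W1 i) + (\<Sum>i\<in>I. W2 i)) / w ^ 3 \<le> n * (4 * M)"
    by (simp add: sum_subtractf n_def sum.distrib flip: sum_divide_distrib sum_distrib_left)
  moreover have "2 * ((\<Sum>i\<in>I. W1 i) + (\<Sum>i\<in>I. W2 i)) / w ^ 3 \<le> 2 * (n * w + n * w) / w ^ 3"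
    using W1(3) W2(3) w(1) n0 K by (intro divide_right_mono mult_left_mono add_mono) (auto simp: w_def)
  moreover have "2 * (n * w + n * w) / w ^ 3 = n * (4 / w ^ 2)"
    using w(1) by (simp add: field_simps power2_eq_square power3_eq_cube)
  moreover have "A - B \<le> C \<Longrightarrow> B \<le> D \<Longrightarrow> D = E \<Longrightarrow> A - E \<le> C" for A B C D E :: real by linarith
  ultimately have "n * (6 / w ^ 2) - n * (4 / w ^ 2) \<le> n * (4 * M)" by blast
  then have "n * (2 / w ^ 2) \<le> n * (4 * M)" by (simp add: field_simps)
  then have "2 / w ^ 2 \<le> 4 * M" by (rule mult_left_le_imp_le) (use n0 in simp)
  then have "2 \<le> 4 * M * w\<^sup>2" using w(1) by (simp add: field_simps)
  then have "2 * (K * n)\<^sup>2 \<le> 4 * M * (2 * real d)\<^sup>2"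
    using K n0 by (simp add: w_def power_divide field_simps)
  then show ?thesis by (simp add: power_mult_distrib n_def)
qed

section \<open>The spectrum of the torus\<close>

definition phase :: "int \<times> int \<Rightarrow> real \<times> real \<Rightarrow> real" where
  "phase k p = 2 * pi * (of_int (fst k) * fst p + of_int (snd k) * snd p)"

text \<open>The Hartley functions cos + sin: unlike cosines and sines taken separately, they form a real
  orthonormal basis indexed by the whole lattice.\<close>
definition cas :: "int \<times> int \<Rightarrow> real \<times> real \<Rightarrow> real" where
  "cas k p = cos (phase k p) + sin (phase k p)"

definition norm2 :: "int \<times> int \<Rightarrow> int" where
  "norm2 k = (fst k)\<^sup>2 + (snd k)\<^sup>2"

lemma continuous_on_phase [continuous_intros]: "continuous_on S (phase k)"
  unfolding phase_def by (intro continuous_intros)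

lemma continuous_on_cas [continuous_intros]: "continuous_on S (cas k)"
  unfolding cas_def by (intro continuous_intros)

lemma phase_periodic: "phase k (x + 1, y) = phase k (x, y) + 2 * pi * of_int (fst k)"
  "phase k (x, y + 1) = phase k (x, y) + 2 * pi * of_int (snd k)"
  by (simp_all add: phase_def algebra_simps)

lemma cos_sin_add_int: "cos (t + 2 * pi * of_int n) = cos t" "sin (t + 2 * pi * of_int n) = sin t"
  by (simp_all add: cos_add sin_add)

lemma periodic2_cas: "periodic2 (cas k)"
  unfolding periodic2_def cas_def phase_periodic cos_sin_add_int by simp

lemma cas_solves_helmholtz: "solves_helmholtz (4 * pi\<^sup>2 * of_int (norm2 k)) (cas k)"
  unfolding solves_helmholtz_def
proof (intro conjI periodic2_cas continuous_on_cas)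
  let ?m = "2 * pi * of_int (fst k) :: real" and ?n = "2 * pi * of_int (snd k) :: real"
  let ?d = "\<lambda>p. cos (phase k p) - sin (phase k p)"
  show "\<exists>ux uy uxx uyy. continuous_on UNIV uxx \<and> continuous_on UNIV uyy \<and>
        (\<forall>x y. ((\<lambda>t. cas k (t, y)) has_real_derivative ux (x, y)) (at x) \<and>
               ((\<lambda>t. ux (t, y)) has_real_derivative uxx (x, y)) (at x) \<and>
               ((\<lambda>t. cas k (x, t)) has_real_derivative uy (x, y)) (at y) \<and>
               ((\<lambda>t. uy (x, t)) has_real_derivative uyy (x, y)) (at y)) \<and>
        (\<forall>p. - (uxx p + uyy p) = 4 * pi\<^sup>2 * of_int (norm2 k) * cas k p)"
    apply (rule exI[of _ "\<lambda>p. ?m * ?d p"], rule exI[of _ "\<lambda>p. ?n * ?d p"],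
        rule exI[of _ "\<lambda>p. - (?m\<^sup>2) * cas k p"], rule exI[of _ "\<lambda>p. - (?n\<^sup>2) * cas k p"])
    apply (intro conjI allI continuous_intros)
        apply (simp_all add: cas_def phase_def norm2_def)
        apply (auto intro!: derivative_eq_intros simp: algebra_simps power2_eq_square)
    done
qed

lemma solves_helmholtz_add:
  assumes "solves_helmholtz lam u" "solves_helmholtz lam w"
  shows "solves_helmholtz lam (\<lambda>p. u p + a * w p)"
proof -
  obtain ux uy uxx uyy where u: "continuous_on UNIV uxx" "continuous_on UNIV uyy"
     "\<And>x y. ((\<lambda>t. u (t, y)) has_real_derivative ux (x, y)) (at x)"
     "\<And>x y. ((\<lambda>t. ux (t, y)) has_real_derivative uxx (x, y)) (at x)"
     "\<And>x y. ((\<lambda>t. u (x, t)) has_real_derivative uy (x, y)) (at y)"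
     "\<And>x y. ((\<lambda>t. uy (x, t)) has_real_derivative uyy (x, y)) (at y)"
     "\<And>p. - (uxx p + uyy p) = lam * u p" and pu: "periodic2 u" "continuous_on UNIV u"
    using assms(1) unfolding solves_helmholtz_def by blast
  obtain wx wy wxx wyy where w: "continuous_on UNIV wxx" "continuous_on UNIV wyy"
     "\<And>x y. ((\<lambda>t. w (t, y)) has_real_derivative wx (x, y)) (at x)"
     "\<And>x y. ((\<lambda>t. wx (t, y)) has_real_derivative wxx (x, y)) (at x)"
     "\<And>x y. ((\<lambda>t. w (x, t)) has_real_derivative wy (x, y)) (at y)"
     "\<And>x y. ((\<lambda>t. wy (x, t)) has_real_derivative wyy (x, y)) (at y)"
     "\<And>p. - (wxx p + wyy p) = lam * w p" and pw: "periodic2 w" "continuous_on UNIV w"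
    using assms(2) unfolding solves_helmholtz_def by blast
  have "- (uxx p + a * wxx p + (uyy p + a * wyy p)) = lam * (u p + a * w p)" for p
  proof -
    have "- (uxx p + a * wxx p + (uyy p + a * wyy p)) = - (uxx p + uyy p) + a * (- (wxx p + wyy p))"
      by (simp add: algebra_simps)
    then show ?thesis unfolding u(7) w(7) by (simp add: algebra_simps)
  qed
  moreover have "periodic2 (\<lambda>p. u p + a * w p)" using pu(1) pw(1) by (simp add: periodic2_def)
  moreover have "continuous_on UNIV (\<lambda>p. u p + a * w p)" "continuous_on UNIV (\<lambda>p. uxx p + a * wxx p)"
    "continuous_on UNIV (\<lambda>p. uyy p + a * wyy p)"
    by (intro continuous_intros pu pw u w)+
  ultimately show ?thesis unfolding solves_helmholtz_def
    by (intro conjI exI[of _ "\<lambda>p. ux p + a * wx p"] exI[of _ "\<lambda>p. uy p + a * wy p"]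
        exI[of _ "\<lambda>p. uxx p + a * wxx p"] exI[of _ "\<lambda>p. uyy p + a * wyy p"] allI DERIV_add DERIV_cmult u w)
qed

lemma solves_helmholtz_zero: "solves_helmholtz lam (\<lambda>p. 0)"
  unfolding solves_helmholtz_def periodic2_def
  by (intro conjI exI[of _ "\<lambda>p. 0"]) auto

lemma solves_helmholtz_sum:
  assumes "finite S" "\<And>k. k \<in> S \<Longrightarrow> solves_helmholtz lam (w k)"
  shows "solves_helmholtz lam (\<lambda>p. \<Sum>k\<in>S. c k * w k p)"
  using assms
proof (induction S)
  case (insert k S)
  then show ?case using solves_helmholtz_add[of lam "\<lambda>p. \<Sum>k\<in>S. c k * w k p" "w k" "c k"]
    by (simp add: add.commute)
qed (simp add: solves_helmholtz_zero)

section \<open>Orthonormality of the Hartley functions\<close>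

abbreviation unit_square :: "(real \<times> real) set" where
  "unit_square \<equiv> cbox (0, 0) (1, 1)"

lemma integral_unit_square_iterated:
  fixes h :: "real \<times> real \<Rightarrow> real"
  assumes h: "continuous_on UNIV h"
  shows "integral unit_square h = integral {0..1} (\<lambda>x. integral {0..1} (\<lambda>y. h (x, y)))"
    and "integral unit_square h = integral {0..1} (\<lambda>y. integral {0..1} (\<lambda>x. h (x, y)))"
    and "h integrable_on unit_square"
proof -
  have c: "continuous_on (cbox (0, 0) (1::real, 1::real)) h" using h continuous_on_subset by blast
  from integral_prod_continuous[OF c] integral_swap_continuous[of 0 0 1 1 "\<lambda>x y. h (x, y)"] c
    integrable_continuous[OF c]
  show "integral unit_square h = integral {0..1} (\<lambda>x. integral {0..1} (\<lambda>y. h (x, y)))"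
    "integral unit_square h = integral {0..1} (\<lambda>y. integral {0..1} (\<lambda>x. h (x, y)))"
    "h integrable_on unit_square"
    by simp_all
qed

lemma integral_cos_sin_period:
  fixes m :: int
  shows "integral {0..1} (\<lambda>x. cos (2 * pi * of_int m * x + c)) = (if m = 0 then cos c else 0)"
    and "integral {0..1} (\<lambda>x. sin (2 * pi * of_int m * x + c)) = (if m = 0 then sin c else 0)"
proof -
  have 1: "integral {0..1} (\<lambda>x. cos (2 * pi * of_int m * x + c)) = (if m = 0 then cos c else 0)" for c
  proof (cases "m = 0")
    case False
    have "((\<lambda>x. cos (2 * pi * of_int m * x + c)) has_integral
        (sin (2 * pi * of_int m * 1 + c) / (2 * pi * of_int m) - sin (2 * pi * of_int m * 0 + c) / (2 * pi * of_int m))) {0..1}"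
      using False by (intro fundamental_theorem_of_calculus)
        (auto intro!: derivative_eq_intros simp flip: has_real_derivative_iff_has_vector_derivative)
    also have "sin (2 * pi * of_int m * 1 + c) = sin c"
      using cos_sin_add_int(2)[of c m] by (simp add: add.commute)
    finally show ?thesis using False by (simp add: integral_unique)
  qed simp
  then show "integral {0..1} (\<lambda>x. cos (2 * pi * of_int m * x + c)) = (if m = 0 then cos c else 0)" .
  show "integral {0..1} (\<lambda>x. sin (2 * pi * of_int m * x + c)) = (if m = 0 then sin c else 0)"
    using 1[of "c - pi / 2"] by (simp add: cos_diff algebra_simps)
qed

lemma integral_cos_sin_phase:
  "integral unit_square (\<lambda>p. cos (phase k p)) = (if k = 0 then 1 else 0)"
  "integral unit_square (\<lambda>p. sin (phase k p)) = 0"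
proof -
  have ph: "phase k (x, y) = 2 * pi * of_int (fst k) * x + 2 * pi * of_int (snd k) * y" for x y
    by (simp add: phase_def algebra_simps)
  have c: "continuous_on UNIV (\<lambda>p. cos (phase k p))" "continuous_on UNIV (\<lambda>p. sin (phase k p))"
    by (intro continuous_intros)+
  show "integral unit_square (\<lambda>p. cos (phase k p)) = (if k = 0 then 1 else 0)"
    unfolding integral_unit_square_iterated(2)[OF c(1)] ph integral_cos_sin_period(1)
    using integral_cos_sin_period(1)[of "snd k" 0]
    by (cases "fst k = 0"; cases "snd k = 0") (simp_all add: prod_eq_iff)
  show "integral unit_square (\<lambda>p. sin (phase k p)) = 0"
    unfolding integral_unit_square_iterated(2)[OF c(2)] ph integral_cos_sin_period(2)
    using integral_cos_sin_period(2)[of "snd k" 0] by (cases "fst k = 0") simp_all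
qed

lemma phase_add: "phase (k + l) p = phase k p + phase l p"
  by (simp add: phase_def algebra_simps)

lemma phase_minus: "phase (- k) p = - phase k p"
  by (simp add: phase_def algebra_simps)

lemma phase_diff: "phase (k - l) p = phase k p - phase l p"
  by (simp add: phase_def algebra_simps)

text \<open>Only the cosine can have a nonzero mean over the square, and only for
  \<open>k = l\<close>; this is why the Hartley functions are orthonormal, with no normalising
  factors.\<close>

lemma cas_mult: "cas k p * cas l p = cos (phase (k - l) p) + sin (phase (k + l) p)"
  by (simp add: cas_def phase_add phase_diff cos_diff sin_add algebra_simps)

lemma cas_orthonormal: "integral unit_square (\<lambda>p. cas k p * cas l p) = (if k = l then 1 else 0)"
proof -
  have "integral unit_square (\<lambda>p. cas k p * cas l p) =
      integral unit_square (\<lambda>p. cos (phase (k - l) p)) + integral unit_square (\<lambda>p. sin (phase (k + l) p))"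
    unfolding cas_mult by (intro integral_add integral_unit_square_iterated(3) continuous_intros)
  then show ?thesis by (simp add: integral_cos_sin_phase)
qed

lemma sum_cas_coefficient:
  assumes "finite S"
  shows "integral unit_square (\<lambda>p. (\<Sum>k\<in>S. c k * cas k p) * cas l p) = (if l \<in> S then c l else 0)"
proof -
  have "integral unit_square (\<lambda>p. (\<Sum>k\<in>S. c k * cas k p) * cas l p) =
      integral unit_square (\<lambda>p. \<Sum>k\<in>S. c k * (cas k p * cas l p))"
    by (simp add: sum_distrib_right mult.assoc)
  also have "\<dots> = (\<Sum>k\<in>S. c k * integral unit_square (\<lambda>p. cas k p * cas l p))"
    by (subst integral_sum[OF assms])
      (auto intro!: integral_unit_square_iterated(3) continuous_intros)
  finally show ?thesis using assms by (simp add: cas_orthonormal if_distrib cong: if_cong)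
qed

section \<open>Fourier coefficients of solutions\<close>

text \<open>Green's identity on each horizontal line, with the primitive
  \<open>ux * cas k - u * d\<close>, where \<open>d\<close> is the horizontal derivative of
  \<open>cas k\<close>; the boundary terms cancel by periodicity.\<close>

lemma horizontal_parts:
  fixes u ux uxx :: "real \<times> real \<Rightarrow> real"
  assumes per: "periodic2 u" "periodic2 ux" and cont: "continuous_on UNIV u" "continuous_on UNIV uxx"
    and ux: "\<And>x y. ((\<lambda>t. u (t, y)) has_real_derivative ux (x, y)) (at x)"
    and uxx: "\<And>x y. ((\<lambda>t. ux (t, y)) has_real_derivative uxx (x, y)) (at x)"
  shows "integral unit_square (\<lambda>p. uxx p * cas k p)
    = - ((2 * pi * of_int (fst k))\<^sup>2 * integral unit_square (\<lambda>p. u p * cas k p))"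
proof -
  let ?m = "2 * pi * of_int (fst k) :: real"
  define d where "d = (\<lambda>p. ?m * (cos (phase k p) - sin (phase k p)))"
  have d: "((\<lambda>t. cas k (t, y)) has_real_derivative d (x, y)) (at x)"
    "((\<lambda>t. d (t, y)) has_real_derivative - (?m\<^sup>2) * cas k (x, y)) (at x)" for x y
    unfolding cas_def d_def phase_def
    by (auto intro!: derivative_eq_intros simp: algebra_simps power2_eq_square)
  have per0: "h (1, y) = h (0, y)" if "periodic2 h" for h :: "real \<times> real \<Rightarrow> real" and y
    using periodic2_of_int[OF that, of 0 1 y 0] by simp
  have pd: "periodic2 d"
    by (rule periodic2_partial[OF periodic2_cas d(1)])
  have line: "integral {0..1} (\<lambda>x. uxx (x, y) * cas k (x, y)) = - (?m\<^sup>2) * integral {0..1} (\<lambda>x. u (x, y) * cas k (x, y))" for y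
  proof -
    have sl: "continuous_on {0..1} (\<lambda>t. h (t, y))" if "continuous_on UNIV h" for h :: "real \<times> real \<Rightarrow> real"
      by (rule continuous_on_compose2[OF that]) (auto intro!: continuous_intros)
    have "((\<lambda>x. uxx (x, y) * cas k (x, y) - u (x, y) * (- (?m\<^sup>2) * cas k (x, y))) has_integral
        ((ux (1, y) * cas k (1, y) - u (1, y) * d (1, y)) - (ux (0, y) * cas k (0, y) - u (0, y) * d (0, y)))) {0..1}"
    proof (rule fundamental_theorem_of_calculus)
      fix x
      have "((\<lambda>x. ux (x, y) * cas k (x, y) - u (x, y) * d (x, y)) has_real_derivative
          (uxx (x, y) * cas k (x, y) + d (x, y) * ux (x, y)) - (ux (x, y) * d (x, y) + (- (?m\<^sup>2) * cas k (x, y)) * u (x, y))) (at x)"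
        by (rule DERIV_diff DERIV_mult ux uxx d)+
      then show "((\<lambda>x. ux (x, y) * cas k (x, y) - u (x, y) * d (x, y)) has_vector_derivative
          uxx (x, y) * cas k (x, y) - u (x, y) * (- (?m\<^sup>2) * cas k (x, y))) (at x within {0..1})"
        by (simp add: algebra_simps has_real_derivative_iff_has_vector_derivative has_vector_derivative_at_within)
    qed simp
    moreover have "uxx (x, y) * cas k (x, y) - u (x, y) * (- (?m\<^sup>2) * cas k (x, y)) =
        uxx (x, y) * cas k (x, y) - (- (?m\<^sup>2)) * (u (x, y) * cas k (x, y))" for x
      by (simp only: mult_ac)
    ultimately have "((\<lambda>x. uxx (x, y) * cas k (x, y) - (- (?m\<^sup>2)) * (u (x, y) * cas k (x, y))) has_integral 0) {0..1}"
      by (simp only: per0[OF per(1)] per0[OF per(2)] per0[OF periodic2_cas] per0[OF pd] diff_self)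
    moreover have "((\<lambda>x. uxx (x, y) * cas k (x, y) - (- (?m\<^sup>2)) * (u (x, y) * cas k (x, y))) has_integral
        (integral {0..1} (\<lambda>x. uxx (x, y) * cas k (x, y)) - (- (?m\<^sup>2)) * integral {0..1} (\<lambda>x. u (x, y) * cas k (x, y)))) {0..1}"
      by (intro has_integral_diff has_integral_mult_right integrable_integral integrable_continuous_interval
          continuous_on_mult sl cont continuous_on_cas)
    ultimately have "integral {0..1} (\<lambda>x. uxx (x, y) * cas k (x, y)) - (- (?m\<^sup>2)) * integral {0..1} (\<lambda>x. u (x, y) * cas k (x, y)) = 0"
      by (rule has_integral_unique[symmetric])
    then show ?thesis by (simp only: right_minus_eq)
  qed
  have c: "continuous_on UNIV (\<lambda>p. u p * cas k p)" "continuous_on UNIV (\<lambda>p. uxx p * cas k p)"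
    by (intro continuous_intros cont)+
  show ?thesis unfolding integral_unit_square_iterated(2)[OF c(1)] integral_unit_square_iterated(2)[OF c(2)] line
    by simp
qed

lemma cas_swap: "cas k (prod.swap p) = cas (prod.swap k) p"
  by (simp add: cas_def phase_def add.commute)

text \<open>Symmetry of the Laplacian: moving the derivatives onto \<open>cas k\<close> multiplies
  the coefficient by 4 pi^2 \<open>norm2 k\<close>, while the equation multiplies it by
  \<open>lam\<close>.\<close>

lemma helmholtz_coefficient:
  assumes sol: "solves_helmholtz lam u" and lam: "lam \<noteq> 4 * pi\<^sup>2 * of_int (norm2 k)"
  shows "integral unit_square (\<lambda>p. u p * cas k p) = 0"
proof -
  obtain ux uy uxx uyy where c: "continuous_on UNIV uxx" "continuous_on UNIV uyy" and
     d: "\<And>x y. ((\<lambda>t. u (t, y)) has_real_derivative ux (x, y)) (at x)"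
        "\<And>x y. ((\<lambda>t. ux (t, y)) has_real_derivative uxx (x, y)) (at x)"
        "\<And>x y. ((\<lambda>t. u (x, t)) has_real_derivative uy (x, y)) (at y)"
        "\<And>x y. ((\<lambda>t. uy (x, t)) has_real_derivative uyy (x, y)) (at y)"
     and eq: "\<And>p. - (uxx p + uyy p) = lam * u p" and p: "periodic2 u" and cu: "continuous_on UNIV u"
    using sol unfolding solves_helmholtz_def by blast
  let ?I = "\<lambda>h. integral unit_square (\<lambda>p. h p * cas k p)"
  have px: "periodic2 ux" using periodic2_partial[OF p d(1)] .
  have py: "periodic2 (\<lambda>p. uy (prod.swap p))"
    by (rule periodic2_partial[of "\<lambda>p. u (prod.swap p)"]) (use p d in \<open>auto simp: periodic2_swap\<close>)
  have x: "?I uxx = - ((2 * pi * of_int (fst k))\<^sup>2 * ?I u)"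
    by (rule horizontal_parts[OF p px cu c(1) d(1,2)])
  have cont: "continuous_on UNIV (\<lambda>p. u p * cas k p)" "continuous_on UNIV (\<lambda>p. uyy p * cas k p)"
     "continuous_on UNIV (\<lambda>p. uxx p * cas k p)"
    by (intro continuous_intros cu c)+
  have "integral unit_square (\<lambda>p. uyy (prod.swap p) * cas (prod.swap k) p) =
      - ((2 * pi * of_int (fst (prod.swap k)))\<^sup>2 * integral unit_square (\<lambda>p. u (prod.swap p) * cas (prod.swap k) p))"
    by (rule horizontal_parts[OF _ py]) (use p cu c d in \<open>auto simp: periodic2_swap continuous_on_swap_iff\<close>)
  then have y: "?I uyy = - ((2 * pi * of_int (snd k))\<^sup>2 * ?I u)"
    using integral_unit_square_swap[OF cont(1)] integral_unit_square_swap[OF cont(2)] by (simp add: cas_swap)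
  have "lam * ?I u = integral unit_square (\<lambda>p. - (uxx p * cas k p) - uyy p * cas k p)"
  proof -
    have "- (uxx p * cas k p) - uyy p * cas k p = lam * (u p * cas k p)" for p
    proof -
      have "- (uxx p * cas k p) - uyy p * cas k p = - (uxx p + uyy p) * cas k p" by (simp add: algebra_simps)
      then show ?thesis unfolding eq by simp
    qed
    then show ?thesis by simp
  qed
  also have "\<dots> = - ?I uxx - ?I uyy"
    using integral_unit_square_iterated(3)[OF cont(2)] integral_unit_square_iterated(3)[OF cont(3)]
    by (subst integral_diff) (auto intro: integrable_neg)
  also have "\<dots> = 4 * pi\<^sup>2 * of_int (norm2 k) * ?I u"
    unfolding x y by (simp add: norm2_def algebra_simps power2_eq_square)
  finally show ?thesis using lam by simp
qed

section \<open>Completeness of the Hartley functions\<close>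

text \<open>Terms are appended one at a time and frequencies may repeat, so closure under sums and
  products is an induction without collecting coefficients.\<close>

inductive trig_polynomial :: "(real \<times> real \<Rightarrow> real) \<Rightarrow> bool" where
  zero: "trig_polynomial (\<lambda>p. 0)"
| add_cas: "trig_polynomial f \<Longrightarrow> trig_polynomial (\<lambda>p. f p + a * cas k p)"

lemma trig_polynomial_add: "trig_polynomial f \<Longrightarrow> trig_polynomial g \<Longrightarrow> trig_polynomial (\<lambda>p. g p + f p)"
proof (induction f rule: trig_polynomial.induct)
  case (add_cas f a k)
  from trig_polynomial.add_cas[OF add_cas.IH[OF add_cas.prems]] show ?case by (simp add: add.assoc)
qed simp

lemma trig_polynomial_cos: "trig_polynomial (\<lambda>p. a * cos (phase k p))"
  and trig_polynomial_sin: "trig_polynomial (\<lambda>p. a * sin (phase k p))"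
proof -
  have t: "trig_polynomial (\<lambda>p. 0 + a / 2 * cas k p + b * cas (- k) p)" for a b
    by (intro trig_polynomial.intros)
  have 1: "0 + a / 2 * cas k p + a / 2 * cas (- k) p = a * cos (phase k p)"
     and 2: "0 + a / 2 * cas k p + (- a / 2) * cas (- k) p = a * sin (phase k p)" for p
    by (simp_all add: cas_def phase_minus field_simps)
  show "trig_polynomial (\<lambda>p. a * cos (phase k p))" "trig_polynomial (\<lambda>p. a * sin (phase k p))"
    using t[of a "a / 2"] t[of a "- a / 2"] unfolding 1 2 by blast+
qed

lemma trig_polynomial_mult: "trig_polynomial f \<Longrightarrow> trig_polynomial g \<Longrightarrow> trig_polynomial (\<lambda>p. f p * g p)"
proof (induction f rule: trig_polynomial.induct)
  case zero
  then show ?case by (simp add: trig_polynomial.zero)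
next
  case (add_cas f a k)
  have "trig_polynomial (\<lambda>p. a * cas k p * g p)"
    using add_cas.prems
  proof (induction g rule: trig_polynomial.induct)
    case zero
    then show ?case by (simp add: trig_polynomial.zero)
  next
    case (add_cas g b l)
    have "a * cas k p * (g p + b * cas l p) =
        a * cas k p * g p + (a * b * cos (phase (k - l) p) + a * b * sin (phase (k + l) p))" for p
      using cas_mult[of k p l] by (simp add: algebra_simps)
    then have eq: "(\<lambda>p. a * cas k p * (g p + b * cas l p)) = (\<lambda>p. a * cas k p * g p +
        (a * b * cos (phase (k - l) p) + a * b * sin (phase (k + l) p)))" by blast
    show ?case unfolding eq
      by (intro trig_polynomial_add trig_polynomial_cos trig_polynomial_sin add_cas.IH)
  qed
  then have "trig_polynomial (\<lambda>p. f p * g p + a * cas k p * g p)"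
    using add_cas by (intro trig_polynomial_add)
  then show ?case by (simp add: distrib_right)
qed

lemma phase_const: "phase 0 p = 0" by (simp add: phase_def)

text \<open>The bridge from Stone-Weierstrass on the embedded torus to Fourier sums. A linear form
  is determined by its values on the real basis \<open>(1, 0)\<close>, \<open>(\<i>, 0)\<close>,
  \<open>(0, 1)\<close>, \<open>(0, \<i>)\<close>.\<close>

lemma real_polynomial_torus_embed:
  assumes "real_polynomial_function q"
  shows "trig_polynomial (\<lambda>p. q (torus_embed p))"
  using assms
proof (induction q rule: real_polynomial_function.induct)
  case (linear f)
  have "torus_embed p = cos (phase (1, 0) p) *\<^sub>R (1, 0) + sin (phase (1, 0) p) *\<^sub>R (\<i>, 0)
      + (cos (phase (0, 1) p) *\<^sub>R (0, 1) + sin (phase (0, 1) p) *\<^sub>R (0, \<i>))" for p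
    by (simp add: torus_embed_def phase_def complex_eq_iff)
  then have eq: "f (torus_embed p) = f (1, 0) * cos (phase (1, 0) p) + f (\<i>, 0) * sin (phase (1, 0) p)
      + (f (0, 1) * cos (phase (0, 1) p) + f (0, \<i>) * sin (phase (0, 1) p))" for p
    by (simp only: linear_add[OF bounded_linear.linear[OF linear]] linear_scale[OF bounded_linear.linear[OF linear]]
        real_scaleR_def mult.commute)
  show ?case unfolding eq by (intro trig_polynomial_add trig_polynomial_cos trig_polynomial_sin)
next
  case (const c)
  then show ?case using trig_polynomial_cos[of c 0] by (simp add: phase_const)
qed (auto intro: trig_polynomial_add trig_polynomial_mult)

lemma torus_embed_eq_iff:
  "torus_embed p = torus_embed q \<longleftrightarrow> (\<exists>m n. p = (fst q + of_int m, snd q + of_int n))"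
proof -
  have "cis (2 * pi * a) = cis (2 * pi * b) \<longleftrightarrow> (\<exists>m. a = b + of_int m)" for a b
  proof
    assume "cis (2 * pi * a) = cis (2 * pi * b)"
    then have "cos (2 * pi * a) = cos (2 * pi * b) \<and> sin (2 * pi * a) = sin (2 * pi * b)"
      by (simp add: complex_eq_iff)
    then obtain n :: int where "2 * pi * a = 2 * pi * b + 2 * pi * of_int n"
      using sin_cos_eq_iff[of "2 * pi * a" "2 * pi * b"] by (auto simp: Ints_def ac_simps)
    then have "2 * pi * a = 2 * pi * (b + of_int n)" by (simp add: distrib_left)
    then have "a = b + of_int n" by (simp only: mult_cancel_left) simp
    then show "\<exists>m. a = b + of_int m" by blast
  next
    assume "\<exists>m. a = b + of_int m"
    then obtain m where m: "a = b + of_int m" by blast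
    have "2 * pi * a = 2 * pi * b + 2 * pi * of_int m" by (simp add: m algebra_simps)
    then show "cis (2 * pi * a) = cis (2 * pi * b)"
      by (simp only: complex_eq_iff cis.simps cos_sin_add_int)
  qed
  then show ?thesis by (auto simp: torus_embed_def prod_eq_iff)
qed

lemma continuous_on_torus_embed [continuous_intros]: "continuous_on S torus_embed"
  unfolding torus_embed_def by (intro continuous_intros)

lemma torus_embed_eqD:
  assumes "periodic2 u" "torus_embed p = torus_embed q"
  shows "u p = u q"
proof -
  obtain m n where "p = (fst q + of_int m, snd q + of_int n)"
    using assms(2) unfolding torus_embed_eq_iff by blast
  then show ?thesis using periodic2_of_int[OF assms(1), of "fst q" m "snd q" n] by simp
qed

lemma range_torus_embed: "range torus_embed = torus_embed ` unit_square"
proof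
  show "range torus_embed \<subseteq> torus_embed ` unit_square"
  proof
    fix z assume "z \<in> range torus_embed"
    then obtain x y where z: "z = torus_embed (x, y)" by auto
    have "torus_embed (x, y) = torus_embed (frac x, frac y)"
      unfolding torus_embed_eq_iff
      by (intro exI[of _ "\<lfloor>x\<rfloor>"] exI[of _ "\<lfloor>y\<rfloor>"]) (simp add: frac_def)
    moreover have "(frac x, frac y) \<in> unit_square" by (simp add: frac_ge_0 frac_lt_1 less_imp_le)
    ultimately show "z \<in> torus_embed ` unit_square" using z by blast
  qed
qed auto

text \<open>\<open>u\<close> descends to a function \<open>F\<close> on the embedded torus, a
  compact set on which real polynomials approximate continuous functions uniformly.\<close>

lemma trig_polynomial_dense:
  assumes u: "periodic2 u" "continuous_on UNIV u" and e: "e > 0"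
  obtains f where "trig_polynomial f" "\<And>p. \<bar>u p - f p\<bar> < e"
proof -
  define T where "T = range torus_embed"
  define F where "F = (\<lambda>z. u (SOME p. torus_embed p = z))"
  have F: "F (torus_embed p) = u p" for p
    unfolding F_def by (rule torus_embed_eqD[OF u(1)], rule someI[of _ p]) simp
  have comp: "compact (torus_embed ` C)" if "compact C" for C
    using that by (intro compact_continuous_image continuous_intros)
  have T: "compact T" unfolding T_def range_torus_embed by (intro comp compact_cbox)
  have "continuous_on T F"
    unfolding continuous_on_closed
  proof (intro allI impI)
    fix C assume "closedin (top_of_set (F ` T)) C"
    then obtain D where D: "closed D" "C = D \<inter> F ` T" by (auto simp: closedin_closed)
    \<comment> \<open>The square maps onto the torus, so a preimage under \<open>F\<close> is the
      image of a compact part of the square and therefore closed.\<close>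
    have "T \<inter> F -` C = torus_embed ` (unit_square \<inter> u -` D)"
    proof (rule set_eqI)
      fix z
      show "z \<in> T \<inter> F -` C \<longleftrightarrow> z \<in> torus_embed ` (unit_square \<inter> u -` D)"
      proof
        assume z: "z \<in> T \<inter> F -` C"
        then obtain p where p: "p \<in> unit_square" "z = torus_embed p" unfolding T_def range_torus_embed by blast
        with z have "u p \<in> D" by (simp add: D(2) F)
        with p show "z \<in> torus_embed ` (unit_square \<inter> u -` D)" by blast
      next
        assume "z \<in> torus_embed ` (unit_square \<inter> u -` D)"
        then obtain p where p: "u p \<in> D" "z = torus_embed p" by blast
        then show "z \<in> T \<inter> F -` C" by (simp add: D(2) F T_def) (metis F rangeI imageI)
      qed
    qed
    moreover have "closed (u -` D)" using D(1) u(2) by (simp add: closed_vimage)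
    ultimately have "closed (T \<inter> F -` C)" by (simp add: comp compact_imp_closed compact_Int_closed)
    then show "closedin (top_of_set T) (T \<inter> F -` C)" by (simp add: closed_subset)
  qed
  from Stone_Weierstrass_real_polynomial_function[OF T this e]
  obtain q where "real_polynomial_function q" "\<And>z. z \<in> T \<Longrightarrow> \<bar>F z - q z\<bar> < e" by blast
  then show ?thesis using that[of "\<lambda>p. q (torus_embed p)"] real_polynomial_torus_embed F
    by (metis T_def rangeI)
qed

text \<open>\<open>u\<close> is orthogonal to every trigonometric polynomial f, so the integral of
  u^2 equals that of u (u - f), which is small once f is uniformly close to
  \<open>u\<close>.\<close>

lemma cas_complete:
  assumes u: "periodic2 u" "continuous_on UNIV u"
    and zero: "\<And>k. integral unit_square (\<lambda>p. u p * cas k p) = 0"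
  shows "u p = 0"
proof (rule periodic2_square_integral_zero[OF u])
  have orth: "continuous_on UNIV f \<and> integral unit_square (\<lambda>p. u p * f p) = 0" if "trig_polynomial f" for f
    using that
  proof induction
    case (add_cas f a k)
    then have c: "continuous_on UNIV (\<lambda>p. u p * f p)" "continuous_on UNIV (\<lambda>p. a * (u p * cas k p))"
      by (intro continuous_intros u; simp)+
    have "integral unit_square (\<lambda>p. u p * f p + a * (u p * cas k p)) = 0"
      using add_cas zero
      by (subst integral_add[OF integral_unit_square_iterated(3)[OF c(1)] integral_unit_square_iterated(3)[OF c(2)]]) simp
    moreover have "u p * (f p + a * cas k p) = u p * f p + a * (u p * cas k p)" for p
      by (simp add: algebra_simps)
    moreover have "continuous_on UNIV (\<lambda>p. f p + a * cas k p)"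
      using add_cas by (intro continuous_intros) simp
    ultimately show ?case by simp
  qed simp
  have cu: "continuous_on UNIV (\<lambda>p. (u p)\<^sup>2)" by (intro continuous_intros u)
  have "compact (u ` unit_square)" using u(2) by (intro compact_continuous_image) (auto intro: continuous_on_subset)
  then have "bounded (u ` unit_square)" by (rule compact_imp_bounded)
  then obtain B where B: "B > 0" "\<And>p. p \<in> unit_square \<Longrightarrow> \<bar>u p\<bar> \<le> B"
    unfolding bounded_pos ball_simps real_norm_def by blast
  have "integral unit_square (\<lambda>p. (u p)\<^sup>2) \<le> 0 + e" if e: "e > 0" for e
  proof -
    have "e / B > 0" using e B by simp
    then obtain f where f: "trig_polynomial f" "\<And>p. \<bar>u p - f p\<bar> < e / B"
      using trig_polynomial_dense[OF u] by blast
    then have cf: "continuous_on UNIV (\<lambda>p. u p * f p)" using orth by (intro continuous_intros u) auto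
    have "integral unit_square (\<lambda>p. (u p)\<^sup>2) = integral unit_square (\<lambda>p. (u p)\<^sup>2 - u p * f p)"
      using orth[OF f(1)]
      by (subst integral_diff[OF integral_unit_square_iterated(3)[OF cu] integral_unit_square_iterated(3)[OF cf]]) simp
    also have "\<dots> \<le> integral unit_square (\<lambda>p. e)"
    proof (rule integral_le)
      fix p assume p: "p \<in> unit_square"
      have "(u p)\<^sup>2 - u p * f p \<le> \<bar>u p\<bar> * \<bar>u p - f p\<bar>"
        by (simp add: power2_eq_square flip: right_diff_distrib abs_mult)
      also have "\<dots> \<le> B * (e / B)" using B(2)[OF p] f(2)[of p] by (intro mult_mono) auto
      finally show "(u p)\<^sup>2 - u p * f p \<le> e" using B(1) by simp
    qed (intro integral_unit_square_iterated(3) continuous_on_diff continuous_on_const cu cf)+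
    also have "\<dots> = e" by (simp add: content_Pair)
    finally show ?thesis by simp
  qed
  then have "integral unit_square (\<lambda>p. (u p)\<^sup>2) \<le> 0" by (rule field_le_epsilon)
  moreover have "integral unit_square (\<lambda>p. (u p)\<^sup>2) \<ge> 0"
    by (rule integral_nonneg[OF integral_unit_square_iterated(3)[OF cu]]) simp
  ultimately show "integral unit_square (\<lambda>p. (u p)\<^sup>2) = 0" by simp
qed

section \<open>Multiplicities and the counting of eigenvalues by lattice points\<close>

definition sphere_pts :: "int \<Rightarrow> (int \<times> int) set" where
  "sphere_pts N = {k. norm2 k = N}"

definition ball_pts :: "int \<Rightarrow> (int \<times> int) set" where
  "ball_pts N = {k. norm2 k < N}"

lemma finite_ball_pts: "finite (ball_pts N)"
proof (rule finite_subset)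
  have bd: "\<bar>a\<bar> \<le> \<bar>N\<bar>" if "a\<^sup>2 + b\<^sup>2 < N" for a b :: int
  proof -
    have "\<bar>a\<bar> \<le> a\<^sup>2"
    proof (cases "a = 0")
      case False
      then have "\<bar>a\<bar> * 1 \<le> \<bar>a\<bar> * \<bar>a\<bar>" by (intro mult_left_mono) auto
      then show ?thesis by (simp add: power2_eq_square)
    qed simp
    then show ?thesis using that zero_le_power2[of b] by linarith
  qed
  show "ball_pts N \<subseteq> {- \<bar>N\<bar>..\<bar>N\<bar>} \<times> {- \<bar>N\<bar>..\<bar>N\<bar>}"
  proof
    fix k assume "k \<in> ball_pts N"
    then have k: "(fst k)\<^sup>2 + (snd k)\<^sup>2 < N" by (simp add: ball_pts_def norm2_def)
    then have "\<bar>fst k\<bar> \<le> \<bar>N\<bar>" "\<bar>snd k\<bar> \<le> \<bar>N\<bar>"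
      using bd[of "fst k" "snd k"] bd[of "snd k" "fst k"] by (simp_all add: add.commute)
    then show "k \<in> {- \<bar>N\<bar>..\<bar>N\<bar>} \<times> {- \<bar>N\<bar>..\<bar>N\<bar>}" by (simp add: mem_Times_iff abs_le_iff)
  qed
qed simp

lemma finite_sphere_pts: "finite (sphere_pts N)"
  by (rule finite_subset[OF _ finite_ball_pts[of "N + 1"]]) (auto simp: sphere_pts_def ball_pts_def)

text \<open>The difference of \<open>u\<close> and its finite Fourier sum is again a solution. Its
  coefficients vanish on \<open>sphere_pts N\<close> by construction and elsewhere because
  \<open>norm2 k\<close> does not match, so completeness makes it zero.\<close>

lemma helmholtz_expansion:
  assumes sol: "solves_helmholtz (4 * pi\<^sup>2 * of_int N) u"
  obtains c where "u = (\<lambda>p. \<Sum>k\<in>sphere_pts N. c k * cas k p)"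
proof -
  define c where "c = (\<lambda>k. integral unit_square (\<lambda>p. u p * cas k p))"
  define w where "w = (\<lambda>p. \<Sum>k\<in>sphere_pts N. c k * cas k p)"
  have "solves_helmholtz (4 * pi\<^sup>2 * of_int N) (cas k)" if "k \<in> sphere_pts N" for k
    using cas_solves_helmholtz[of k] that by (simp add: sphere_pts_def)
  from solves_helmholtz_sum[OF finite_sphere_pts this, where c=c]
  have w: "solves_helmholtz (4 * pi\<^sup>2 * of_int N) w" unfolding w_def .
  have sol': "solves_helmholtz (4 * pi\<^sup>2 * of_int N) (\<lambda>p. u p + (- 1) * w p)"
    by (rule solves_helmholtz_add[OF sol w])
  have cu: "continuous_on UNIV u" "continuous_on UNIV w"
    using sol w unfolding solves_helmholtz_def by blast+
  have ci: "continuous_on UNIV (\<lambda>p. u p * cas k p)" "continuous_on UNIV (\<lambda>p. w p * cas k p)" for k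
    by (intro continuous_intros cu)+
  have "integral unit_square (\<lambda>p. (\<lambda>p. u p + (- 1) * w p) p * cas k p) = 0" for k
  proof (cases "k \<in> sphere_pts N")
    case True
    have "integral unit_square (\<lambda>p. (u p + (- 1) * w p) * cas k p) =
       integral unit_square (\<lambda>p. u p * cas k p - w p * cas k p)" by (simp add: algebra_simps)
    also have "\<dots> = c k - integral unit_square (\<lambda>p. w p * cas k p)"
      unfolding c_def
      by (rule integral_diff[OF integral_unit_square_iterated(3)[OF ci(1)] integral_unit_square_iterated(3)[OF ci(2)]])
    also have "\<dots> = 0" unfolding w_def sum_cas_coefficient[OF finite_sphere_pts] using True by simp
    finally show ?thesis .
  next
    case False
    then show ?thesis using helmholtz_coefficient[OF sol', of k] by (simp add: sphere_pts_def)
  qed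
  moreover have "periodic2 (\<lambda>p. u p + (- 1) * w p)" "continuous_on UNIV (\<lambda>p. u p + (- 1) * w p)"
    using sol' unfolding solves_helmholtz_def by blast+
  ultimately have "u p + (- 1) * w p = 0" for p using cas_complete[of "\<lambda>p. u p + (- 1) * w p" p] by blast
  then have "u = w" by (intro ext) (simp add: algebra_simps)
  then show ?thesis using that unfolding w_def by blast
qed

lemma cas_nonzero: "\<exists>p. cas k p \<noteq> 0"
  by (rule exI[of _ 0]) (simp add: cas_def phase_def)

lemma torus_eigenvalue_iff: "torus_eigenvalue lam \<longleftrightarrow> (\<exists>k. lam = 4 * pi\<^sup>2 * of_int (norm2 k))"
proof
  assume "torus_eigenvalue lam"
  then obtain u where u: "solves_helmholtz lam u" "\<exists>p. u p \<noteq> 0"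
    by (auto simp: torus_eigenvalue_def torus_eigenfunction_def)
  show "\<exists>k. lam = 4 * pi\<^sup>2 * of_int (norm2 k)"
  proof (rule ccontr)
    assume "\<not> ?thesis"
    then have "integral unit_square (\<lambda>p. u p * cas k p) = 0" for k
      using helmholtz_coefficient[OF u(1), of k] by blast
    moreover have "periodic2 u" "continuous_on UNIV u" using u(1) unfolding solves_helmholtz_def by blast+
    ultimately have "u p = 0" for p using cas_complete[of u p] by blast
    then show False using u(2) by simp
  qed
next
  assume "\<exists>k. lam = 4 * pi\<^sup>2 * of_int (norm2 k)"
  then show "torus_eigenvalue lam"
    using cas_solves_helmholtz cas_nonzero unfolding torus_eigenvalue_def torus_eigenfunction_def by blast
qed

text \<open>Gaussian elimination with more unknowns than equations: the equation \<open>k\<close> is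
  solved for a pivot unknown \<open>g\<close> and substituted into the others, which removes one
  equation and one unknown.\<close>

lemma homogeneous_system_solution:
  fixes a :: "'f \<Rightarrow> 'k \<Rightarrow> real"
  assumes "finite S" "finite F" "card S < card F"
  shows "\<exists>c. (\<exists>f\<in>F. c f \<noteq> 0) \<and> (\<forall>k\<in>S. (\<Sum>f\<in>F. c f * a f k) = 0)"
  using assms
proof (induction S arbitrary: F a rule: finite_induct)
  case empty
  then obtain f where "f \<in> F" by fastforce
  then show ?case by (intro exI[of _ "\<lambda>_. 1"]) auto
next
  case (insert k S)
  show ?case
  proof (cases "\<forall>f\<in>F. a f k = 0")
    case True
    obtain c where "\<exists>f\<in>F. c f \<noteq> 0" "\<forall>k\<in>S. (\<Sum>f\<in>F. c f * a f k) = 0"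
      using insert.IH[of F a, OF insert.prems(1)] insert.prems(2) insert.hyps by fastforce
    then show ?thesis using True by (intro exI[of _ c]) simp
  next
    case False
    then obtain g where g: "g \<in> F" "a g k \<noteq> 0" by blast
    define b where "b = (\<lambda>f j. a f j - a f k / a g k * a g j)"
    have "card S < card (F - {g})" using insert g by simp
    then obtain c where c: "\<exists>f\<in>F - {g}. c f \<noteq> 0" "\<forall>j\<in>S. (\<Sum>f\<in>F - {g}. c f * b f j) = 0"
      using insert.IH[of "F - {g}" b] insert.prems(1) by blast
    define c' where "c' = c(g := - (\<Sum>f\<in>F - {g}. c f * (a f k / a g k)))"
    have "(\<Sum>f\<in>F. c' f * a f j) = (\<Sum>f\<in>F - {g}. c f * b f j)" for j
    proof -
      have "(\<Sum>f\<in>F. c' f * a f j) = c' g * a g j + (\<Sum>f\<in>F - {g}. c' f * a f j)"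
        using sum.remove[OF insert.prems(1) g(1)] .
      also have "(\<Sum>f\<in>F - {g}. c' f * a f j) = (\<Sum>f\<in>F - {g}. c f * a f j)"
        by (rule sum.cong) (auto simp: c'_def)
      also have "c' g * a g j + \<dots> = (\<Sum>f\<in>F - {g}. c f * b f j)"
        by (simp add: c'_def b_def right_diff_distrib sum_subtractf sum_distrib_right mult.assoc)
      finally show ?thesis .
    qed
    moreover have "b f k = 0" for f using g(2) by (simp add: b_def)
    moreover have "\<exists>f\<in>F. c' f \<noteq> 0" using c(1) by (auto simp: c'_def)
    ultimately show ?thesis using c(2) by (intro exI[of _ c']) auto
  qed
qed

lemma inj_cas: "inj cas"
proof (rule injI)
  fix k l assume "cas k = cas l"
  then have "integral unit_square (\<lambda>p. cas k p * cas l p) = integral unit_square (\<lambda>p. cas l p * cas l p)" by simp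
  then show "k = l" unfolding cas_orthonormal by (auto split: if_splits)
qed

text \<open>The Hartley functions on the sphere attain the supremum. Expanding a larger family of
  solutions in them leaves a homogeneous system with more unknowns than equations, and a nontrivial
  solution of it is a linear dependence.\<close>

lemma eig_mult_eq: "eig_mult (4 * pi\<^sup>2 * of_int N) = card (sphere_pts N)"
  unfolding eig_mult_def
proof (rule cSup_eq_maximum)
  let ?lam = "4 * pi\<^sup>2 * of_int N :: real"
  have "lin_indep_fun (cas ` sphere_pts N)"
    unfolding lin_indep_fun_def
  proof (intro conjI allI impI ballI)
    fix c f assume c: "\<forall>p. (\<Sum>f\<in>cas ` sphere_pts N. c f * f p) = 0" and "f \<in> cas ` sphere_pts N"
    then obtain k where k: "k \<in> sphere_pts N" "f = cas k" by blast
    have eq: "(\<Sum>k\<in>sphere_pts N. c (cas k) * cas k p) = (\<Sum>f\<in>cas ` sphere_pts N. c f * f p)" for p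
      by (subst sum.reindex[OF inj_on_subset[OF inj_cas subset_UNIV]]) simp
    have "(\<Sum>k\<in>sphere_pts N. c (cas k) * cas k p) = 0" for p unfolding eq using c by blast
    then have "integral unit_square (\<lambda>p. (\<Sum>k\<in>sphere_pts N. c (cas k) * cas k p) * cas k p) = 0" by simp
    then show "c f = 0" unfolding sum_cas_coefficient[OF finite_sphere_pts] using k by simp
  qed (simp add: finite_sphere_pts)
  moreover have "cas ` sphere_pts N \<subseteq> {u. solves_helmholtz ?lam u}"
    using cas_solves_helmholtz by (auto simp: sphere_pts_def)
  moreover have "card (cas ` sphere_pts N) = card (sphere_pts N)"
    by (rule card_image) (rule inj_on_subset[OF inj_cas], simp)
  ultimately show "card (sphere_pts N) \<in> {card F |F. F \<subseteq> {u. solves_helmholtz ?lam u} \<and> lin_indep_fun F}"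
    unfolding mem_Collect_eq by (intro exI[of _ "cas ` sphere_pts N"]) simp
  fix n assume "n \<in> {card F |F. F \<subseteq> {u. solves_helmholtz ?lam u} \<and> lin_indep_fun F}"
  then obtain F where F: "n = card F" "F \<subseteq> {u. solves_helmholtz ?lam u}" "finite F"
    and indep: "\<And>c. \<forall>p. (\<Sum>f\<in>F. c f * f p) = 0 \<Longrightarrow> \<forall>f\<in>F. c f = 0"
    by (auto simp: lin_indep_fun_def)
  have "\<forall>f\<in>F. \<exists>a. \<forall>p. f p = (\<Sum>k\<in>sphere_pts N. a k * cas k p)"
  proof
    fix f assume "f \<in> F"
    then have "solves_helmholtz ?lam f" using F(2) by blast
    from helmholtz_expansion[OF this] obtain a where "f = (\<lambda>p. \<Sum>k\<in>sphere_pts N. a k * cas k p)" .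
    then show "\<exists>a. \<forall>p. f p = (\<Sum>k\<in>sphere_pts N. a k * cas k p)" by (intro exI[of _ a]) simp
  qed
  from bchoice[OF this] obtain a where a: "\<forall>f\<in>F. \<forall>p. f p = (\<Sum>k\<in>sphere_pts N. a f k * cas k p)" ..
  show "n \<le> card (sphere_pts N)"
  proof (rule ccontr)
    assume "\<not> ?thesis"
    then obtain c where c: "\<exists>f\<in>F. c f \<noteq> 0" "\<forall>k\<in>sphere_pts N. (\<Sum>f\<in>F. c f * a f k) = 0"
      using homogeneous_system_solution[OF finite_sphere_pts F(3), of N a] F(1) by auto
    have "(\<Sum>f\<in>F. c f * f p) = 0" for p
    proof -
      have "(\<Sum>f\<in>F. c f * f p) = (\<Sum>f\<in>F. \<Sum>k\<in>sphere_pts N. c f * a f k * cas k p)"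
      proof (rule sum.cong[OF refl])
        fix f assume "f \<in> F"
        then have "f p = (\<Sum>k\<in>sphere_pts N. a f k * cas k p)" using a by blast
        then show "c f * f p = (\<Sum>k\<in>sphere_pts N. c f * a f k * cas k p)"
          by (simp add: sum_distrib_left mult.assoc)
      qed
      also have "\<dots> = (\<Sum>k\<in>sphere_pts N. (\<Sum>f\<in>F. c f * a f k) * cas k p)"
        by (subst sum.swap) (simp add: sum_distrib_right)
      also have "\<dots> = 0" using c(2) by simp
      finally show ?thesis .
    qed
    then show False using indep[of c] c(1) by blast
  qed
qed

text \<open>Each eigenvalue below contributes one sphere of lattice points, and these spheres
  partition the ball; the strict inequality in \<open>ball_pts\<close> mirrors the one in
  \<open>nu\<close>.\<close>

lemma nu_eq: "nu (4 * pi\<^sup>2 * of_int N) = 1 + card (ball_pts N)"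
proof -
  let ?f = "\<lambda>n::int. 4 * pi\<^sup>2 * of_int n :: real"
  have inj: "inj ?f" by (rule injI) simp
  have eq: "{m. torus_eigenvalue m \<and> m < ?f N} = ?f ` (norm2 ` ball_pts N)"
    by (auto simp: torus_eigenvalue_iff ball_pts_def)
  have "(\<Sum>m\<in>{m. torus_eigenvalue m \<and> m < ?f N}. eig_mult m) = (\<Sum>n\<in>norm2 ` ball_pts N. card (sphere_pts n))"
    unfolding eq by (simp add: sum.reindex inj_on_subset[OF inj] eig_mult_eq)
  also have "\<dots> = card (\<Union>n\<in>norm2 ` ball_pts N. sphere_pts n)"
    by (rule card_UN_disjoint[symmetric])
      (simp_all add: finite_ball_pts finite_sphere_pts, auto simp: sphere_pts_def)
  also have "(\<Union>n\<in>norm2 ` ball_pts N. sphere_pts n) = ball_pts N"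
    by (auto simp: ball_pts_def sphere_pts_def)
  finally show ?thesis by (simp add: nu_def)
qed

section \<open>The bound on the number of nodal domains\<close>

text \<open>Multiplied by z^d with z = exp (2 pi i t), \<open>f\<close> becomes a polynomial in z of
  degree at most \<open>2 * d\<close>. As z determines t in [0, 1), distinct zeros give distinct
  roots.\<close>

lemma trig_zeros_bound:
  fixes \<theta> c :: "'k \<Rightarrow> real" and n :: "'k \<Rightarrow> int" and d :: nat and S :: "'k set"
  defines "f \<equiv> \<lambda>t. \<Sum>k\<in>S. c k * (cos (\<theta> k + 2 * pi * of_int (n k) * t) + sin (\<theta> k + 2 * pi * of_int (n k) * t))"
  assumes S: "finite S" and n: "\<And>k. k \<in> S \<Longrightarrow> \<bar>n k\<bar> \<le> int d"
  shows "(\<forall>t. f t = 0) \<or> finite {t \<in> {0..<1}. f t = 0} \<and> card {t \<in> {0..<1}. f t = 0} \<le> 2 * d"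
proof -
  \<comment> \<open>From cos a + sin a = (1 - i)/2 exp (i a) + (1 + i)/2 exp (- i a); the bound on
    \<open>n k\<close> keeps both exponents nonnegative.\<close>
  define P :: "complex poly" where
    "P = (\<Sum>k\<in>S. monom (of_real (c k) * ((1 - \<i>) / 2) * cis (\<theta> k)) (nat (int d + n k))
      + monom (of_real (c k) * ((1 + \<i>) / 2) * cis (- \<theta> k)) (nat (int d - n k)))"
  have P: "poly P (cis (2 * pi * t)) = cis (2 * pi * t) ^ d * of_real (f t)" for t
  proof -
    have eq: "of_real (c k) * ((1 - \<i>) / 2) * cis (\<theta> k) * cis (2 * pi * t) ^ nat (int d + n k)
      + of_real (c k) * ((1 + \<i>) / 2) * cis (- \<theta> k) * cis (2 * pi * t) ^ nat (int d - n k)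
      = cis (2 * pi * t) ^ d * of_real (c k * (cos (\<theta> k + 2 * pi * of_int (n k) * t) + sin (\<theta> k + 2 * pi * of_int (n k) * t)))"
      if k: "k \<in> S" for k
    proof -
      let ?b = "2 * pi * of_int (n k) * t"
      have 1: "real (nat (int d + n k)) * (2 * pi * t) = real d * (2 * pi * t) + ?b"
        "real (nat (int d - n k)) * (2 * pi * t) = real d * (2 * pi * t) + - ?b"
        using n[OF k] by (auto simp: algebra_simps)
      have z1: "cis (2 * pi * t) ^ nat (int d + n k) = cis (2 * pi * t) ^ d * cis ?b"
        using arg_cong[OF 1(1), of cis] by (simp only: Complex.DeMoivre cis_mult)
      have z2: "cis (2 * pi * t) ^ nat (int d - n k) = cis (2 * pi * t) ^ d * cis (- ?b)"
        using arg_cong[OF 1(2), of cis] by (simp only: Complex.DeMoivre cis_mult)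
      have cas: "(1 - \<i>) / 2 * cis a + (1 + \<i>) / 2 * cis (- a) = of_real (cos a + sin a)" for a
        by (simp add: complex_eq_iff field_simps)
      have "of_real (c k) * ((1 - \<i>) / 2) * cis (\<theta> k) * cis (2 * pi * t) ^ nat (int d + n k)
          + of_real (c k) * ((1 + \<i>) / 2) * cis (- \<theta> k) * cis (2 * pi * t) ^ nat (int d - n k)
        = cis (2 * pi * t) ^ d * of_real (c k) *
          ((1 - \<i>) / 2 * (cis (\<theta> k) * cis ?b) + (1 + \<i>) / 2 * (cis (- \<theta> k) * cis (- ?b)))"
        unfolding z1 z2 by (simp only: algebra_simps)
      also have "cis (\<theta> k) * cis ?b = cis (\<theta> k + ?b)" by (rule cis_mult)
      also have "cis (- \<theta> k) * cis (- ?b) = cis (- (\<theta> k + ?b))" by (simp add: cis_mult)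
      finally show ?thesis unfolding cas of_real_mult by (simp only: mult.assoc)
    qed
    have "poly P (cis (2 * pi * t)) = (\<Sum>k\<in>S. cis (2 * pi * t) ^ d *
        of_real (c k * (cos (\<theta> k + 2 * pi * of_int (n k) * t) + sin (\<theta> k + 2 * pi * of_int (n k) * t))))"
      unfolding P_def poly_sum poly_add poly_monom by (rule sum.cong[OF refl eq])
    then show ?thesis unfolding f_def of_real_sum sum_distrib_left .
  qed
  show ?thesis
  proof (cases "P = 0")
    case True
    then have "cis (2 * pi * t) ^ d * of_real (f t) = 0" for t using P[of t] by simp
    then show ?thesis by simp
  next
    case False
    have inj: "inj_on (\<lambda>t. cis (2 * pi * t)) {t \<in> {0..<1}. f t = 0}"
    proof (rule inj_onI)
      fix s t assume st: "s \<in> {t \<in> {0..<1}. f t = 0}" "t \<in> {t \<in> {0..<1}. f t = 0}"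
        "cis (2 * pi * s) = cis (2 * pi * t)"
      then have "torus_embed (s, 0) = torus_embed (t, 0)" by (simp add: torus_embed_def)
      then obtain m :: int where "s = t + of_int m" unfolding torus_embed_eq_iff by auto
      moreover from this have "m = 0" using st(1,2) by auto
      ultimately show "s = t" by simp
    qed
    have sub: "(\<lambda>t. cis (2 * pi * t)) ` {t \<in> {0..<1}. f t = 0} \<subseteq> {z. poly P z = 0}"
      by (auto simp: P)
    have fin: "finite {z. poly P z = 0}" using False by (rule poly_roots_finite)
    have "card {z. poly P z = 0} \<le> degree P" using False by (rule card_poly_roots_bound)
    also have "degree P \<le> 2 * d"
      unfolding P_def
    proof (rule degree_sum_le[OF S])
      fix k assume k: "k \<in> S"
      show "degree (monom (of_real (c k) * ((1 - \<i>) / 2) * cis (\<theta> k)) (nat (int d + n k))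
      + monom (of_real (c k) * ((1 + \<i>) / 2) * cis (- \<theta> k)) (nat (int d - n k))) \<le> 2 * d"
        by (rule degree_add_le; rule order_trans[OF degree_monom_le]) (use n[OF k] in auto)
    qed
    finally show ?thesis
      using inj_on_finite[OF inj sub fin] card_inj_on_le[OF inj sub fin] by simp
  qed
qed

lemma cas_sum_zeros:
  fixes S :: "(int \<times> int) set" and c :: "int \<times> int \<Rightarrow> real" and d :: nat
  assumes S: "finite S" and n: "\<And>k. k \<in> S \<Longrightarrow> \<bar>fst k\<bar> \<le> int d \<and> \<bar>snd k\<bar> \<le> int d"
  defines "v \<equiv> \<lambda>p. \<Sum>k\<in>S. c k * cas k p"
  shows "(\<forall>t. v (x, t) = 0) \<or> finite {t \<in> {0..<1}. v (x, t) = 0} \<and> card {t \<in> {0..<1}. v (x, t) = 0} \<le> 2 * d"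
    and "(\<forall>t. v (t, y) = 0) \<or> finite {t \<in> {0..<1}. v (t, y) = 0} \<and> card {t \<in> {0..<1}. v (t, y) = 0} \<le> 2 * d"
proof -
  have 1: "phase k (x, t) = 2 * pi * of_int (fst k) * x + 2 * pi * of_int (snd k) * t" for k t
    by (simp add: phase_def algebra_simps)
  have 2: "phase k (t, y) = 2 * pi * of_int (snd k) * y + 2 * pi * of_int (fst k) * t" for k t
    by (simp add: phase_def algebra_simps)
  show "(\<forall>t. v (x, t) = 0) \<or> finite {t \<in> {0..<1}. v (x, t) = 0} \<and> card {t \<in> {0..<1}. v (x, t) = 0} \<le> 2 * d"
    unfolding v_def cas_def 1 by (rule trig_zeros_bound[OF S]) (use n in blast)
  show "(\<forall>t. v (t, y) = 0) \<or> finite {t \<in> {0..<1}. v (t, y) = 0} \<and> card {t \<in> {0..<1}. v (t, y) = 0} \<le> 2 * d"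
    unfolding v_def cas_def 2 by (rule trig_zeros_bound[OF S]) (use n in blast)
qed

lemma torus_embed_image_iff:
  assumes "periodic2 u"
  shows "torus_embed p \<in> torus_embed ` {p. u p \<noteq> 0} \<longleftrightarrow> u p \<noteq> 0"
  using torus_embed_eqD[OF assms] by (metis (mono_tags, lifting) image_iff mem_Collect_eq)

text \<open>Pulling back along multiplication by 1 + b i tests the nodal domains against the two closed
  geodesics of directions (1, b) and (-b, 1).\<close>
lemma nodal_domains_bound:
  fixes b :: int and d :: nat
  assumes u: "solves_helmholtz (4 * pi\<^sup>2 * of_int N) u" and fin: "finite (nodal_domains u)"
    and d: "1 \<le> d" "\<And>j. j\<^sup>2 \<le> (1 + b\<^sup>2) * N \<Longrightarrow> \<bar>j\<bar> \<le> int d" and n: "3 * d \<le> num_nodal_domains u"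
  shows "(1 + real_of_int b ^ 2) * (real (num_nodal_domains u))\<^sup>2 \<le> 8 * of_int N * (real d)\<^sup>2"
proof -
  define K where "K = 1 + real_of_int b ^ 2"
  have K: "K > 0" unfolding K_def by (rule add_pos_nonneg) simp_all
  \<comment> \<open>Multiplication by 1 + b i, which scales lengths by sqrt K; \<open>T\<close> is
    its transpose, acting on frequencies. Hence \<open>v\<close> solves the equation with
    \<open>K * N\<close> in place of \<open>N\<close>.\<close>
  define L where "L = (\<lambda>p. (fst p - of_int b * snd p, of_int b * fst p + snd p) :: real \<times> real)"
  define T where "T = (\<lambda>k::int \<times> int. (fst k + b * snd k, snd k - b * fst k))"
  define v where "v = (\<lambda>p. u (L p))"
  define G where "G = (\<lambda>D. {p. torus_embed (L p) \<in> D})"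
  have pu: "periodic2 u" using u unfolding solves_helmholtz_def by blast
  have L: "continuous_on S L" for S unfolding L_def by (intro continuous_intros)
  have normT: "norm2 (T k) = (1 + b\<^sup>2) * norm2 k" for k
    by (simp add: norm2_def T_def power2_eq_square algebra_simps)
  have inj: "inj T"
  proof (rule injI)
    fix k l assume "T k = T l"
    then have "T (k - l) = 0" by (simp add: T_def prod_eq_iff algebra_simps)
    then have "(1 + b\<^sup>2) * norm2 (k - l) = 0" using normT[of "k - l"] by (simp add: norm2_def)
    moreover have "1 + b\<^sup>2 > 0" by (rule add_pos_nonneg) simp_all
    ultimately have "norm2 (k - l) = 0" by simp
    then show "k = l" by (simp add: norm2_def prod_eq_iff)
  qed
  obtain c where c: "u = (\<lambda>p. \<Sum>k\<in>sphere_pts N. c k * cas k p)" using helmholtz_expansion[OF u] .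
  have casT: "cas k (L p) = cas (T k) p" for k p
    by (simp add: cas_def phase_def L_def T_def algebra_simps)
  have v: "v = (\<lambda>p. \<Sum>k\<in>T ` sphere_pts N. c (inv T k) * cas k p)"
    unfolding v_def c casT by (subst sum.reindex[OF inj_on_subset[OF inj subset_UNIV]]) (simp add: inv_f_f[OF inj])
  have finT: "finite (T ` sphere_pts N)" by (simp add: finite_sphere_pts)
  have "solves_helmholtz (4 * pi\<^sup>2 * of_int ((1 + b\<^sup>2) * N)) (cas k)" if k: "k \<in> T ` sphere_pts N" for k
  proof -
    obtain l where "k = T l" "norm2 l = N" using k unfolding sphere_pts_def by blast
    then show ?thesis using cas_solves_helmholtz[of k] by (simp only: normT)
  qed
  from solves_helmholtz_sum[OF finT this, where c="\<lambda>k. c (inv T k)"]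
  have sol: "solves_helmholtz (4 * pi\<^sup>2 * (K * of_int N)) v" unfolding v by (simp add: K_def)
  have deg: "\<bar>fst k\<bar> \<le> int d \<and> \<bar>snd k\<bar> \<le> int d" if k: "k \<in> T ` sphere_pts N" for k
  proof -
    obtain l where l: "k = T l" "norm2 l = N" using k unfolding sphere_pts_def by blast
    then have "(fst k)\<^sup>2 + (snd k)\<^sup>2 = (1 + b\<^sup>2) * N" using normT[of l] by (simp add: norm2_def)
    then show ?thesis using d(2)[of "fst k"] d(2)[of "snd k"] zero_le_power2[of "fst k"] zero_le_power2[of "snd k"]
      by linarith
  qed
  have zeros1: "(\<forall>t. v (x, t) = 0) \<or> finite {t \<in> {0..<1}. v (x, t) = 0} \<and> card {t \<in> {0..<1}. v (x, t) = 0} \<le> 2 * d" for x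
    unfolding v by (rule cas_sum_zeros(1)[OF finT deg])
  have zeros2: "(\<forall>t. v (t, y) = 0) \<or> finite {t \<in> {0..<1}. v (t, y) = 0} \<and> card {t \<in> {0..<1}. v (t, y) = 0} \<le> 2 * d" for y
    unfolding v by (rule cas_sum_zeros(2)[OF finT deg])
  let ?X = "torus_embed ` {p. u p \<noteq> 0}"
  have comp: "D \<in> components ?X" if "D \<in> nodal_domains u" for D using that by (simp add: nodal_domains_def)
  \<comment> \<open>Translations that \<open>L\<close> turns into integer vectors preserve the
    lifted domains. Besides the unit lattice these include (1 / K, - b / K) and (b / K, 1 / K), the
    preimages of the unit vectors, which supply the period 1 / K along each axis.\<close>
  have shift: "(p + q) \<in> G D \<longleftrightarrow> p \<in> G D" if "fst (L q) = of_int m" "snd (L q) = of_int n" for p q D m n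
  proof -
    have "L (p + q) = (fst (L p) + of_int m, snd (L p) + of_int n)"
      using that by (simp add: L_def algebra_simps)
    then have "torus_embed (L (p + q)) = torus_embed (L p)" unfolding torus_embed_eq_iff by blast
    then show ?thesis by (simp add: G_def)
  qed
  have "K\<^sup>2 * (real (card (nodal_domains u)))\<^sup>2 \<le> 8 * (K * of_int N) * (real d)\<^sup>2"
  proof (rule saturated_family_bound[where v=v and G=G and \<sigma>="- of_int b / K" and \<tau>="of_int b / K"])
    show "saturated v (G D)" if D: "D \<in> nodal_domains u" for D
      unfolding saturated_def
    proof (intro conjI allI impI)
      show "G D \<subseteq> {p. v p \<noteq> 0}"
      proof
        fix p assume "p \<in> G D"
        then have "torus_embed (L p) \<in> ?X" using in_components_subset[OF comp[OF D]] by (auto simp: G_def)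
        then show "p \<in> {p. v p \<noteq> 0}" using torus_embed_image_iff[OF pu, of "L p"] by (simp add: v_def)
      qed
      fix S assume S: "connected S \<and> S \<subseteq> {p. v p \<noteq> 0} \<and> S \<inter> G D \<noteq> {}"
      have "connected ((\<lambda>p. torus_embed (L p)) ` S)"
        using S by (intro connected_continuous_image continuous_on_compose2[OF continuous_on_torus_embed L]) auto
      moreover have "(\<lambda>p. torus_embed (L p)) ` S \<subseteq> ?X" using S by (auto simp: v_def)
      moreover have "D \<inter> (\<lambda>p. torus_embed (L p)) ` S \<noteq> {}" using S by (auto simp: G_def)
      ultimately have "(\<lambda>p. torus_embed (L p)) ` S \<subseteq> D" by (intro components_maximal[OF comp[OF D]])
      then show "S \<subseteq> G D" by (auto simp: G_def)
    qed
    show "G D \<noteq> {}" if D: "D \<in> nodal_domains u" for D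
    proof -
      have "D \<noteq> {}" "D \<subseteq> ?X" using in_components_nonempty[OF comp[OF D]] in_components_subset[OF comp[OF D]] .
      then obtain x y where xy: "torus_embed (x, y) \<in> D" by fastforce
      \<comment> \<open>The witness is the preimage of \<open>(x, y)\<close> under
        \<open>L\<close>.\<close>
      have "L ((x + of_int b * y) / K, (y - of_int b * x) / K) = (x * K / K, y * K / K)"
        unfolding L_def fst_conv snd_conv prod.inject times_divide_eq_right diff_divide_distrib[symmetric]
          add_divide_distrib[symmetric]
        by (simp add: K_def algebra_simps power2_eq_square)
      then have "((x + of_int b * y) / K, (y - of_int b * x) / K) \<in> G D" using xy K by (simp add: G_def)
      then show ?thesis by blast
    qed
    show "G D \<inter> G E = {}" if "D \<in> nodal_domains u" "E \<in> nodal_domains u" "D \<noteq> E" for D E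
      using components_nonoverlap[OF comp[OF that(1)] comp[OF that(2)]] that(3) by (auto simp: G_def)
    show "periodic_set (G D)" for D
      unfolding periodic_set_def
    proof (intro allI conjI)
      fix x y
      show "(x + 1, y) \<in> G D \<longleftrightarrow> (x, y) \<in> G D"
        using shift[of "(1, 0)" 1 b "(x, y)" D] by (simp add: L_def)
      show "(x, y + 1) \<in> G D \<longleftrightarrow> (x, y) \<in> G D"
        using shift[of "(0, 1)" "- b" 1 "(x, y)" D] by (simp add: L_def)
    qed
    have 1: "1 / K + of_int b * (of_int b / K) = 1"
      using K by (simp add: K_def field_simps power2_eq_square)
    show "(x + 1 / K, y + - of_int b / K) \<in> G D \<longleftrightarrow> (x, y) \<in> G D" for D x y
      using shift[of "(1 / K, - of_int b / K)" 1 0 "(x, y)" D] 1 by (simp add: L_def)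
    show "(x + of_int b / K, y + 1 / K) \<in> G D \<longleftrightarrow> (x, y) \<in> G D" for D x y
      using shift[of "(of_int b / K, 1 / K)" 0 1 "(x, y)" D] 1 by (simp add: L_def add.commute)
  qed (use n in \<open>simp_all only: sol fin K zeros1 zeros2 d(1) num_nodal_domains_def\<close>)
  \<comment> \<open>The period 1 / K gains a factor K^2 and the larger eigenvalue costs a factor K,
    so one K survives the cancellation.\<close>
  then have "K * (K * (real (num_nodal_domains u))\<^sup>2) \<le> K * (8 * of_int N * (real d)\<^sup>2)"
    by (simp add: num_nodal_domains_def power2_eq_square algebra_simps)
  then show ?thesis using K unfolding K_def[symmetric] by (rule mult_left_le_imp_le)
qed

section \<open>Counting lattice points\<close>

text \<open>Machin's formula with a cubic lower bound for arctan (1 / 5) and a linear upper bound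
  for arctan (1 / 239) gives about 3.1406. The margin over sqrt 8 decides from which
  \<open>N\<close> on the area comparison suffices.\<close>

lemma pi_ge_314: "3.14 \<le> pi"
proof -
  have lower: "x - x ^ 3 / 3 \<le> arctan x" if x: "0 \<le> x" for x
  proof -
    have "arctan 0 - 0 + 0 ^ 3 / 3 \<le> arctan x - x + x ^ 3 / 3"
    proof (rule DERIV_nonneg_imp_nondecreasing[OF x])
      fix t :: real
      have "((\<lambda>x. arctan x - x + x ^ 3 / 3) has_real_derivative inverse (1 + t\<^sup>2) - 1 + t\<^sup>2) (at t)"
        by (auto intro!: derivative_eq_intros)
      moreover have "0 \<le> inverse (1 + t\<^sup>2) - 1 + t\<^sup>2"
      proof -
        have p: "0 < 1 + t\<^sup>2" by (rule add_pos_nonneg) simp_all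
        have "inverse (1 + t\<^sup>2) - 1 + t\<^sup>2 = t ^ 4 / (1 + t\<^sup>2)"
          using p by (simp add: field_simps power2_eq_square power4_eq_xxxx)
        also have "\<dots> \<ge> 0" using p by simp
        finally show ?thesis .
      qed
      ultimately show "\<exists>y. ((\<lambda>x. arctan x - x + x ^ 3 / 3) has_real_derivative y) (at t) \<and> 0 \<le> y" by blast
    qed
    then show ?thesis by simp
  qed
  have upper: "arctan x \<le> x" if x: "0 \<le> x" for x
  proof -
    have "0 - arctan 0 \<le> x - arctan x"
    proof (rule DERIV_nonneg_imp_nondecreasing[OF x])
      fix t :: real
      have "((\<lambda>x. x - arctan x) has_real_derivative 1 - inverse (1 + t\<^sup>2)) (at t)"
        by (auto intro!: derivative_eq_intros)
      moreover have "0 \<le> 1 - inverse (1 + t\<^sup>2)" by (simp add: inverse_le_1_iff)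
      ultimately show "\<exists>y. ((\<lambda>x. x - arctan x) has_real_derivative y) (at t) \<and> 0 \<le> y" by blast
    qed
    then show ?thesis by simp
  qed
  have "pi = 16 * arctan (1 / 5) - 4 * arctan (1 / 239)" using machin by simp
  moreover have "1 / 5 - (1 / 5) ^ 3 / 3 \<le> arctan (1 / 5)" "arctan (1 / 239) \<le> 1 / 239"
    by (rule lower upper; simp)+
  ultimately show ?thesis by (simp add: power3_eq_cube)
qed

text \<open>Comparing areas: the unit squares centred at the lattice points in the disc of radius sqrt N cover
  the disc of radius sqrt N - sqrt 2 / 2.\<close>
lemma card_ball_pts_ge_area:
  assumes r: "0 \<le> r" "r + sqrt 2 / 2 \<le> sqrt (of_int N)"
  shows "pi * r\<^sup>2 \<le> real (card (ball_pts N))"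
proof -
  define Q where "Q = (\<lambda>k::int \<times> int. cbox (real_of_int (fst k) - 1 / 2, real_of_int (snd k) - 1 / 2)
      (real_of_int (fst k) + 1 / 2, real_of_int (snd k) + 1 / 2))"
  have cover: "ball 0 r \<subseteq> (\<Union>k\<in>ball_pts N. Q k)"
  proof
    fix p :: "real \<times> real" assume p: "p \<in> ball 0 r"
    obtain x y where xy: "p = (x, y)" by fastforce
    \<comment> \<open>Rounding both coordinates picks a square that contains \<open>p\<close>; its
      centre is at most half a diagonal, sqrt 2 / 2, away.\<close>
    define k where "k = (round x, round y)"
    have k: "\<bar>of_int (fst k) - x\<bar> \<le> 1 / 2" "\<bar>of_int (snd k) - y\<bar> \<le> 1 / 2"
      using of_int_round_abs_le[of x] of_int_round_abs_le[of y] by (simp_all add: k_def)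
    then have "of_int (fst k) - 1 / 2 \<le> x" "x \<le> of_int (fst k) + 1 / 2"
      "of_int (snd k) - 1 / 2 \<le> y" "y \<le> of_int (snd k) + 1 / 2" by linarith+
    then have Q: "p \<in> Q k" unfolding Q_def xy cbox_Pair_eq by simp
    have "norm (of_int (fst k) - x, of_int (snd k) - y) \<le> sqrt ((1 / 2)\<^sup>2 + (1 / 2)\<^sup>2)"
      unfolding norm_Pair using k by (intro real_sqrt_le_mono add_mono) (simp_all add: abs_le_square_iff[symmetric])
    also have "\<dots> = sqrt 2 / 2" by (simp add: real_sqrt_divide power2_eq_square field_simps)
    finally have n1: "norm (of_int (fst k) - x, of_int (snd k) - y) \<le> sqrt 2 / 2" .
    have "(real_of_int (fst k), real_of_int (snd k)) = p + (of_int (fst k) - x, of_int (snd k) - y)"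
      by (simp add: xy)
    then have "norm (real_of_int (fst k), real_of_int (snd k)) \<le> norm p + norm (of_int (fst k) - x, of_int (snd k) - y)"
      using norm_triangle_ineq by metis
    also have "\<dots> < sqrt (of_int N)" using n1 p r by simp
    finally have "real_of_int (norm2 k) < of_int N"
      unfolding norm_Pair real_sqrt_less_iff by (simp add: norm2_def)
    then have "norm2 k < N" by (simp only: of_int_less_iff)
    then have "k \<in> ball_pts N" by (simp add: ball_pts_def)
    with Q show "p \<in> (\<Union>k\<in>ball_pts N. Q k)" by blast
  qed
  have Q1: "measure lborel (Q k) = 1" for k
    unfolding Q_def by (simp add: content_Pair)
  have "measure lborel (ball (0 :: real \<times> real) r) = pi * r\<^sup>2"
  proof -
    have "DIM(real \<times> real) = 2" by simp
    with content_ball[OF r(1), of "0 :: real \<times> real"] show ?thesis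
      by (simp only: of_nat_numeral unit_ball_vol_2)
  qed
  moreover have "measure lborel (ball (0 :: real \<times> real) r) \<le> measure lborel (\<Union>k\<in>ball_pts N. Q k)"
  proof (rule measure_mono_fmeasurable[OF cover])
    have "Q k \<in> fmeasurable lborel" for k unfolding Q_def by (rule fmeasurable_cbox)
    then show "(\<Union>k\<in>ball_pts N. Q k) \<in> fmeasurable lborel" by (intro fmeasurable.finite_UN finite_ball_pts)
  qed simp
  moreover have "\<dots> \<le> (\<Sum>k\<in>ball_pts N. measure lborel (Q k))"
    by (rule measure_UNION_le[OF finite_ball_pts]) (simp add: Q_def)
  ultimately show ?thesis by (simp add: Q1)
qed

text \<open>Contradicts \<open>nodal_domains_bound\<close> with \<open>b = 0\<close> when the number
  of nodal domains is \<open>nu\<close>, that is, 1 + \<open>card (ball_pts N)\<close>.\<close>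

definition lattice_gap :: "int \<Rightarrow> bool" where
  "lattice_gap N \<longleftrightarrow> (\<exists>d::nat. 1 \<le> d \<and> (\<forall>j. j\<^sup>2 \<le> N \<longrightarrow> \<bar>j\<bar> \<le> int d) \<and>
     8 * real_of_int N * (real d)\<^sup>2 < (1 + real (card (ball_pts N)))\<^sup>2)"

text \<open>With s = sqrt N and d \<le> s it suffices that sqrt 8 s^2 < 1 + pi (s - sqrt 2 / 2)^2.
  Replacing sqrt 8, pi and sqrt 2 / 2 by 2.8285, 3.14 and 0.7072 leaves a quadratic that is positive
  from s = 14 on, and 14^2 = 196.\<close>

lemma lattice_gap_large:
  assumes N: "196 \<le> N"
  shows "lattice_gap N"
proof -
  define s where "s = sqrt (of_int N)"
  define d where "d = nat \<lfloor>s\<rfloor>"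
  have s2: "s\<^sup>2 = of_int N" using N by (simp add: s_def)
  have "sqrt 196 \<le> s" unfolding s_def using N by (intro real_sqrt_le_mono) simp
  moreover have "sqrt 196 = (14::real)" by (rule real_sqrt_unique) simp_all
  ultimately have s: "14 \<le> s" by simp
  have d: "real d \<le> s" "1 \<le> d" using s by (auto simp: d_def le_nat_iff le_floor_iff)
  have dj: "\<bar>j\<bar> \<le> int d" if "j\<^sup>2 \<le> N" for j
  proof -
    have "(real_of_int \<bar>j\<bar>)\<^sup>2 \<le> s\<^sup>2" unfolding s2 using that by (simp flip: of_int_power)
    then have "real_of_int \<bar>j\<bar> \<le> s" by (rule power2_le_imp_le) (use s in simp)
    then show ?thesis using s by (simp add: d_def le_floor_iff)
  qed
  have "sqrt 2 \<le> (1.4144::real)" by (rule real_le_lsqrt) (simp_all add: power2_eq_square)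
  then have sq2: "sqrt 2 / 2 \<le> (0.7072::real)" by simp
  have "3.14 * (s - 0.7072)\<^sup>2 \<le> pi * (s - 0.7072)\<^sup>2"
    using pi_ge_314 by (intro mult_right_mono) auto
  also have "\<dots> \<le> real (card (ball_pts N))"
    by (rule card_ball_pts_ge_area) (use s sq2 in \<open>auto simp: s_def\<close>)
  finally have c: "3.14 * (s - 0.7072)\<^sup>2 \<le> real (card (ball_pts N))" .
  \<comment> \<open>A minorant of the required quadratic with 14 as an exact root: 0.3115 = 3.14 -
    2.8285, 4.4413 rounds up 3.14 * 1.4144, and 0.0803 = 4.4413 - 14 * 0.3115.\<close>
  have "0 \<le> (s - 14) * (0.3115 * s - 0.0803)" using s by (intro mult_nonneg_nonneg) auto
  also have "(s - 14) * (0.3115 * s - 0.0803) = 0.3115 * s\<^sup>2 - 4.4413 * s + 1.1242"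
    by (simp add: power2_eq_square field_simps)
  finally have "0 \<le> 0.3115 * s\<^sup>2 - 4.4413 * s + 1.1242" .
  moreover have "(s - 0.7072)\<^sup>2 = s\<^sup>2 - 1.4144 * s + 0.50013184"
    by (simp add: power2_eq_square algebra_simps)
  ultimately have "2.8285 * s\<^sup>2 < 1 + 3.14 * (s - 0.7072)\<^sup>2"
    using s by (simp add: algebra_simps)
  then have "2.8285 * s\<^sup>2 < 1 + real (card (ball_pts N))" using c by simp
  then have "(2.8285 * s\<^sup>2)\<^sup>2 < (1 + real (card (ball_pts N)))\<^sup>2"
    by (rule power_strict_mono) simp_all
  moreover have "8 * s\<^sup>2 * (real d)\<^sup>2 \<le> (2.8285 * s\<^sup>2)\<^sup>2"
  proof -
    have "8 * s\<^sup>2 * (real d)\<^sup>2 \<le> 8 * s\<^sup>2 * s\<^sup>2" using d(1) by (intro mult_left_mono power_mono) auto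
    also have "\<dots> \<le> 2.8285\<^sup>2 * (s\<^sup>2 * s\<^sup>2)" unfolding mult.assoc by (rule mult_right_mono) (simp_all add: power2_eq_square)
    finally show ?thesis by (simp only: power_mult_distrib power2_eq_square[of "s\<^sup>2"])
  qed
  ultimately show ?thesis unfolding lattice_gap_def s2 using d dj by (intro exI[of _ d]) auto
qed

section \<open>The remaining finite range, by computation\<close>

text \<open>A list, so that \<open>code_simp\<close> can evaluate the count. Restricting to a box
  can only lose lattice points, which is safe for a lower bound.\<close>

definition lattice_count :: "int \<Rightarrow> int \<Rightarrow> nat" where
  "lattice_count d N = length (filter (\<lambda>(a, b). a * a + b * b < N) (List.product [-d..d] [-d..d]))"

lemma lattice_count_le: "lattice_count d N \<le> card (ball_pts N)"
proof -
  let ?xs = "filter (\<lambda>(a, b). a * a + b * b < N) (List.product [-d..d] [-d..d])"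
  have "distinct ?xs" by (intro distinct_filter distinct_product) simp_all
  from distinct_card[OF this] have "lattice_count d N = card (set ?xs)" by (simp only: lattice_count_def)
  also have "\<dots> \<le> card (ball_pts N)"
    by (rule card_mono[OF finite_ball_pts]) (auto simp: ball_pts_def norm2_def power2_eq_square)
  finally show ?thesis .
qed

lemma ball_pts_mono: "M \<le> N \<Longrightarrow> card (ball_pts M) \<le> card (ball_pts N)"
  by (rule card_mono[OF finite_ball_pts]) (auto simp: ball_pts_def)

text \<open>An entry (a, b, d, r) covers the N in [a, b], where d is the integer part of the square root and
  r is the number of lattice points of norm below a. The values 4 and 25 are missing: there the bound
  with b = 0 fails.\<close>
definition gap_table :: "(int \<times> int \<times> int \<times> nat) list" where
  "gap_table = [(2, 3, 1, 5), (5, 6, 2, 13), (7, 8, 2, 21), (9, 9, 3, 25), (10, 12, 3, 29),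
    (13, 15, 3, 37), (16, 16, 4, 45), (17, 19, 4, 49), (20, 24, 4, 61), (26, 33, 5, 81),
    (34, 35, 5, 101), (36, 42, 6, 109), (43, 48, 6, 137), (49, 54, 7, 145), (55, 63, 7, 177),
    (64, 73, 8, 193), (74, 80, 8, 233), (81, 96, 9, 249), (97, 99, 9, 293), (100, 117, 10, 305),
    (118, 120, 10, 373), (121, 143, 11, 373), (144, 166, 12, 437), (167, 168, 12, 517),
    (169, 195, 13, 517)]"

lemma gap_table_count: "list_all (\<lambda>(a, b, d, r). lattice_count d a = r) gap_table"
  by code_simp

lemma gap_table_bounds:
  "list_all (\<lambda>(a, b, d, r). 1 \<le> d \<and> b < (d + 1)\<^sup>2 \<and> 8 * b * d\<^sup>2 < (1 + int r)\<^sup>2) gap_table"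
  by (simp add: gap_table_def)

lemma gap_table_covers:
  assumes "2 \<le> N" "N < 196" "N \<noteq> 4" "N \<noteq> 25"
  shows "\<exists>(a, b, d, r)\<in>set gap_table. a \<le> N \<and> N \<le> b"
  unfolding gap_table_def using assms by (simp only: list.set bex_simps split_conv) presburger

text \<open>Within a table entry the left side of the gap inequality is largest at \<open>b\<close>
  and the lattice count is smallest at \<open>a\<close>, so one comparison of these extremes settles
  the whole range.\<close>

lemma lattice_gap:
  assumes "2 \<le> N" "N \<noteq> 4" "N \<noteq> 25"
  shows "lattice_gap N"
proof (cases "N < 196")
  case True
  then obtain a b d r where t: "(a, b, d, r) \<in> set gap_table" "a \<le> N" "N \<le> b"
    using gap_table_covers[OF assms(1) _ assms(2,3)] by auto
  have c: "lattice_count d a = r" using gap_table_count t(1) unfolding list_all_iff by fastforce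
  have b: "1 \<le> d" "b < (d + 1)\<^sup>2" "8 * b * d\<^sup>2 < (1 + int r)\<^sup>2"
    using gap_table_bounds t(1) unfolding list_all_iff by fastforce+
  have "\<bar>j\<bar> \<le> d" if "j\<^sup>2 \<le> N" for j
  proof -
    have "\<bar>j\<bar>\<^sup>2 < (d + 1)\<^sup>2" using that t(3) b(2) by simp
    then have "\<bar>j\<bar> < d + 1" by (rule power_less_imp_less_base) (use b in simp)
    then show ?thesis by simp
  qed
  moreover have "8 * N * d\<^sup>2 < (1 + int (card (ball_pts N)))\<^sup>2"
  proof -
    have "r \<le> card (ball_pts N)" using lattice_count_le[of d a] c ball_pts_mono[OF t(2)] by simp
    then have "(1 + int r)\<^sup>2 \<le> (1 + int (card (ball_pts N)))\<^sup>2" by (intro power_mono) auto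
    moreover have "8 * N * d\<^sup>2 \<le> 8 * b * d\<^sup>2" using t(3) by (intro mult_right_mono) auto
    ultimately show ?thesis using b(3) by linarith
  qed
  then have "real_of_int (8 * N * d\<^sup>2) < real_of_int ((1 + int (card (ball_pts N)))\<^sup>2)"
    by (simp only: of_int_less_iff)
  ultimately show ?thesis unfolding lattice_gap_def using b(1) by (intro exI[of _ "nat d"]) auto
next
  case False
  then show ?thesis by (intro lattice_gap_large) simp
qed

section \<open>Courant-sharp eigenvalues\<close>

text \<open>An infinite set has \<open>card\<close> 0, whereas \<open>nu\<close> is at least
  1.\<close>

lemma finite_nodal_domains_if_sharp:
  assumes "num_nodal_domains u = nu lam"
  shows "finite (nodal_domains u)"
  using assms by (auto simp: num_nodal_domains_def nu_def intro: card_ge_0_finite)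

lemma norm2_le_cases:
  assumes "norm2 k \<le> 1"
  shows "k \<in> {(0, 0), (1, 0), (-1, 0), (0, 1), (0, -1)}"
proof -
  have "a \<in> {-1, 0, 1}" if "a\<^sup>2 \<le> 1" for a :: int
    using that abs_square_le_1[of a] by auto
  moreover have "(fst k)\<^sup>2 \<le> 1" "(snd k)\<^sup>2 \<le> 1"
    using assms zero_le_power2[of "fst k"] zero_le_power2[of "snd k"] unfolding norm2_def by linarith+
  ultimately have "fst k \<in> {-1, 0, 1}" "snd k \<in> {-1, 0, 1}" by blast+
  then show ?thesis using assms by (cases k) (auto simp: norm2_def)
qed

lemma norm2_nonneg: "0 \<le> norm2 k"
  by (simp add: norm2_def)

lemma ball_pts_0: "ball_pts 0 = {}"
  using norm2_nonneg by (auto simp: ball_pts_def not_less)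

lemma ball_pts_1: "ball_pts 1 = {(0, 0)}"
proof -
  have "k = (0, 0)" if "norm2 k < 1" for k
    using norm2_le_cases[of k] that by (auto simp: norm2_def)
  then show ?thesis by (auto simp: ball_pts_def norm2_def)
qed

lemma sphere_pts_0: "sphere_pts 0 = {(0, 0)}"
proof -
  have "k = (0, 0)" if "norm2 k = 0" for k
    using norm2_le_cases[of k] that by (auto simp: norm2_def)
  then show ?thesis by (auto simp: sphere_pts_def norm2_def)
qed

lemma sphere_pts_1: "sphere_pts 1 = {(1, 0), (-1, 0), (0, 1), (0, -1)}"
proof -
  have "k \<in> {(1, 0), (-1, 0), (0, 1), (0, -1)}" if "norm2 k = 1" for k
    using norm2_le_cases[of k] that by (auto simp: norm2_def)
  then show ?thesis by (auto simp: sphere_pts_def norm2_def)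
qed

lemma nu_low: "nu 0 = 1" "nu (4 * pi\<^sup>2) = 2" "eig_mult 0 = 1" "eig_mult (4 * pi\<^sup>2) = 4"
  using nu_eq[of 0] nu_eq[of 1] eig_mult_eq[of 0] eig_mult_eq[of 1]
  by (simp_all add: ball_pts_0 ball_pts_1 sphere_pts_0 sphere_pts_1)

lemma not_courant_sharp:
  assumes N: "2 \<le> N"
  shows "\<not> courant_sharp (4 * pi\<^sup>2 * of_int N)"
proof
  assume "courant_sharp (4 * pi\<^sup>2 * of_int N)"
  then obtain u where u: "solves_helmholtz (4 * pi\<^sup>2 * of_int N) u"
    "num_nodal_domains u = nu (4 * pi\<^sup>2 * of_int N)"
    unfolding courant_sharp_def torus_eigenfunction_def by blast
  have n: "num_nodal_domains u = 1 + card (ball_pts N)" using u(2) by (simp only: nu_eq)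
  note bound = nodal_domains_bound[OF u(1) finite_nodal_domains_if_sharp[OF u(2)], unfolded n]
  consider "N = 4" | "N = 25" | "N \<noteq> 4" "N \<noteq> 25" by blast
  then show False
  proof cases
    case 1
    \<comment> \<open>Here \<open>nu\<close> is 10, and the axes only give 100 \<le> 8 * 4 * 2^2 =
      128. With \<open>b = 1\<close> the degree bound is still 2, and 2 * 100 \<le> 128 is
      false.\<close>
    have "lattice_count 2 4 = 9" by code_simp
    then have c: "9 \<le> card (ball_pts N)" using lattice_count_le[of 2 4] 1 by simp
    have j: "\<bar>j\<bar> \<le> int 2" if "j\<^sup>2 \<le> (1 + 1\<^sup>2) * N" for j :: int
    proof -
      have "\<bar>j\<bar>\<^sup>2 < 3\<^sup>2" using that 1 by simp
      then have "\<bar>j\<bar> < 3" by (rule power_less_imp_less_base) simp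
      then show ?thesis by simp
    qed
    have "100 \<le> (real (1 + card (ball_pts N)))\<^sup>2"
      using power_mono[of 10 "real (1 + card (ball_pts N))" 2] c by simp
    then show False using bound[of 2 1] j c 1 by simp
  next
    case 2
    \<comment> \<open>Here \<open>nu\<close> is 70. The axes allow 4900 \<le> 5000, and
      \<open>b = 1\<close> with d = 7 allows equality, 9800 on both sides. With \<open>b = 2\<close>
      and d = 11 a contradiction appears: 5 * 4900 = 24500 exceeds 8 * 25 * 11^2 = 24200.\<close>
    have "lattice_count 5 25 = 69" by code_simp
    then have c: "69 \<le> card (ball_pts N)" using lattice_count_le[of 5 25] 2 by simp
    have j: "\<bar>j\<bar> \<le> int 11" if "j\<^sup>2 \<le> (1 + 2\<^sup>2) * N" for j :: int
    proof -
      have "\<bar>j\<bar>\<^sup>2 < 12\<^sup>2" using that 2 by simp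
      then have "\<bar>j\<bar> < 12" by (rule power_less_imp_less_base) simp
      then show ?thesis by simp
    qed
    have "4900 \<le> (real (1 + card (ball_pts N)))\<^sup>2"
      using power_mono[of 70 "real (1 + card (ball_pts N))" 2] c by simp
    then show False using bound[of 11 2] j c 2 by simp
  next
    case 3
    then obtain d :: nat where d: "1 \<le> d" "\<And>j. j\<^sup>2 \<le> N \<Longrightarrow> \<bar>j\<bar> \<le> int d"
      and gap: "8 * real_of_int N * (real d)\<^sup>2 < (1 + real (card (ball_pts N)))\<^sup>2"
      using lattice_gap[OF N] unfolding lattice_gap_def by blast
    \<comment> \<open>The side condition that the number of domains is at least \<open>3 * d\<close>
      comes out of the gap itself, as 9 \<le> 8 N.\<close>
    have "(3 * real d)\<^sup>2 \<le> 8 * real_of_int N * (real d)\<^sup>2"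
      unfolding power_mult_distrib using N by (intro mult_right_mono) auto
    with gap have "(3 * real d)\<^sup>2 < (1 + real (card (ball_pts N)))\<^sup>2" by linarith
    then have "3 * real d < 1 + real (card (ball_pts N))" by (rule power_less_imp_less_base) simp
    then have "3 * d \<le> 1 + card (ball_pts N)" by linarith
    then show False using bound[of d 0] d gap by simp
  qed
qed

lemma courant_sharp_0: "courant_sharp 0"
  unfolding courant_sharp_def
proof (intro exI conjI)
  have "solves_helmholtz 0 (\<lambda>p. 1)"
    unfolding solves_helmholtz_def periodic2_def
    by (intro conjI exI[of _ "\<lambda>p. 0"]) auto
  then show "torus_eigenfunction 0 (\<lambda>p. 1)" by (simp add: torus_eigenfunction_def)
  have "connected (range torus_embed)"
    by (intro connected_continuous_image continuous_intros convex_connected convex_UNIV)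
  then have "nodal_domains (\<lambda>p. 1) = {range torus_embed}"
    unfolding nodal_domains_def by (simp add: components_eq_sing_iff)
  then show "num_nodal_domains (\<lambda>p. 1) = nu 0" by (simp add: num_nodal_domains_def nu_low)
qed

text \<open>The nodal domains of sin (2 pi x) are the images of two open strips, told apart by the
  sign of the imaginary part of the first coordinate.\<close>

lemma courant_sharp_1: "courant_sharp (4 * pi\<^sup>2)"
  unfolding courant_sharp_def
proof (intro exI conjI)
  define u where "u = (\<lambda>p::real \<times> real. sin (2 * pi * fst p))"
  have "u = (\<lambda>p. (0 + (1 / 2) * cas (1, 0) p) + (- 1 / 2) * cas (-1, 0) p)"
    by (rule ext) (simp add: u_def cas_def phase_def field_simps)
  moreover have "solves_helmholtz (4 * pi\<^sup>2) (cas (1, 0))" "solves_helmholtz (4 * pi\<^sup>2) (cas (-1, 0))"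
    using cas_solves_helmholtz[of "(1, 0)"] cas_solves_helmholtz[of "(-1, 0)"] by (simp_all add: norm2_def)
  ultimately have "solves_helmholtz (4 * pi\<^sup>2) u"
    using solves_helmholtz_add[OF solves_helmholtz_add[OF solves_helmholtz_zero]] by metis
  moreover have "u (1 / 4, 0) \<noteq> 0" by (simp add: u_def)
  ultimately show "torus_eigenfunction (4 * pi\<^sup>2) u" unfolding torus_eigenfunction_def by blast
  define A where "A = (\<lambda>s::real. torus_embed ` ({s<..<s + 1 / 2} \<times> UNIV))"
  have conA: "connected (A s)" for s
    unfolding A_def by (intro connected_continuous_image continuous_intros connected_Times) simp_all
  have pos: "0 < sin (2 * pi * t)" if "0 < t" "t < 1 / 2" for t
    using that by (intro sin_gt_zero) (simp_all add: field_simps)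
  have neg: "sin (2 * pi * t) < 0" if "- 1 / 2 < t" "t < 0" for t
    using pos[of "- t"] that by simp
  have imA: "A 0 \<subseteq> {z. 0 < Im (fst z)}" "A (- 1 / 2) \<subseteq> {z. Im (fst z) < 0}"
    using pos neg by (auto simp: A_def torus_embed_def)
  have ne: "A s \<noteq> {}" for s unfolding A_def by (auto simp: Sigma_empty_iff)
  have split: "torus_embed ` {p. u p \<noteq> 0} = A 0 \<union> A (- 1 / 2)"
  proof
    have "sin (2 * pi * t) \<noteq> 0" if "0 < t \<and> t < 1 / 2 \<or> - 1 / 2 < t \<and> t < 0" for t
      using pos[of t] neg[of t] that by auto
    then show "A 0 \<union> A (- 1 / 2) \<subseteq> torus_embed ` {p. u p \<noteq> 0}" by (auto simp: A_def u_def)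
    show "torus_embed ` {p. u p \<noteq> 0} \<subseteq> A 0 \<union> A (- 1 / 2)"
    proof
      fix z assume "z \<in> torus_embed ` {p. u p \<noteq> 0}"
      then obtain x y where z: "z = torus_embed (x, y)" "u (x, y) \<noteq> 0" by auto
      \<comment> \<open>The representative of \<open>x\<close> modulo 1 in [-1/2, 1/2), where the
        sine vanishes only at -1/2 and 0.\<close>
      define t where "t = x - of_int \<lfloor>x + 1 / 2\<rfloor>"
      have zt: "z = torus_embed (t, y)" unfolding z torus_embed_eq_iff t_def
        by (intro exI[of _ "\<lfloor>x + 1 / 2\<rfloor>"] exI[of _ 0]) simp
      have x: "x = t + of_int \<lfloor>x + 1 / 2\<rfloor>" by (simp add: t_def)
      have "2 * pi * x = 2 * pi * t + 2 * pi * of_int \<lfloor>x + 1 / 2\<rfloor>"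
        by (subst x) (simp add: distrib_left)
      then have "sin (2 * pi * t) \<noteq> 0" using z(2) by (simp only: u_def fst_conv cos_sin_add_int) simp
      then have "t \<noteq> 0" "t \<noteq> - 1 / 2" by auto
      moreover have "- 1 / 2 \<le> t" "t < 1 / 2" unfolding t_def by linarith+
      ultimately have "t \<in> {0<..<1 / 2} \<or> t \<in> {- 1 / 2<..<0}" by auto
      then show "z \<in> A 0 \<union> A (- 1 / 2)" unfolding zt A_def by auto
    qed
  qed
  have maxA: "B \<in> components (A 0 \<union> A (- 1 / 2))"
    if B: "B = A 0 \<and> C = A (- 1 / 2) \<or> B = A (- 1 / 2) \<and> C = A 0" for B C
    unfolding in_components_maximal
  proof (intro conjI allI impI)
    show "B \<noteq> {}" "connected B" "B \<subseteq> A 0 \<union> A (- 1 / 2)" using B ne conA by auto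
    fix D assume D: "D \<noteq> {} \<and> B \<subseteq> D \<and> D \<subseteq> A 0 \<union> A (- 1 / 2) \<and> connected D"
    let ?P = "{z::complex \<times> complex. 0 < Im (fst z)}" and ?M = "{z::complex \<times> complex. Im (fst z) < 0}"
    have op: "open ?P" "open ?M" by (intro open_Collect_less continuous_intros)+
    have "?P \<inter> D = {} \<or> ?M \<inter> D = {}"
      by (rule connectedD[OF _ op]) (use D imA in auto)
    then show "D = B" using D B imA ne[of 0] ne[of "- 1 / 2"] by blast
  qed
  have "components (A 0 \<union> A (- 1 / 2)) = {A 0, A (- 1 / 2)}"
  proof
    show "{A 0, A (- 1 / 2)} \<subseteq> components (A 0 \<union> A (- 1 / 2))" using maxA by blast
    show "components (A 0 \<union> A (- 1 / 2)) \<subseteq> {A 0, A (- 1 / 2)}"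
    proof
      fix D assume D: "D \<in> components (A 0 \<union> A (- 1 / 2))"
      then obtain z where "z \<in> D" "z \<in> A 0 \<union> A (- 1 / 2)"
        using in_components_nonempty in_components_subset by blast
      then show "D \<in> {A 0, A (- 1 / 2)}"
        using components_nonoverlap[OF D maxA[of "A 0" "A (- 1 / 2)"]]
          components_nonoverlap[OF D maxA[of "A (- 1 / 2)" "A 0"]] by blast
    qed
  qed
  moreover have "A 0 \<noteq> A (- 1 / 2)" using imA ne[of 0] by fastforce
  ultimately show "num_nodal_domains u = nu (4 * pi\<^sup>2)"
    by (simp add: num_nodal_domains_def nodal_domains_def split nu_low)
qed

text \<open>All further eigenvalues start at index 6 or later, which makes the definite description
  in \<open>lambda_k k\<close> unique for \<open>k\<close> up to 5.\<close>

lemma nu_large: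
  assumes "2 \<le> N"
  shows "6 \<le> nu (4 * pi\<^sup>2 * of_int N)"
proof -
  have "card (sphere_pts 0 \<union> sphere_pts 1) \<le> card (ball_pts N)"
    using assms by (intro card_mono[OF finite_ball_pts]) (auto simp: ball_pts_def sphere_pts_def)
  moreover have "card (sphere_pts 0 \<union> sphere_pts 1) = 5" by (simp add: sphere_pts_0 sphere_pts_1)
  ultimately show ?thesis unfolding nu_eq by linarith
qed

lemma torus_eigenvalue_cases:
  assumes "torus_eigenvalue lam"
  obtains "lam = 0" | "lam = 4 * pi\<^sup>2" | N where "2 \<le> N" "lam = 4 * pi\<^sup>2 * of_int N"
proof -
  obtain k where k: "lam = 4 * pi\<^sup>2 * of_int (norm2 k)" using assms by (auto simp: torus_eigenvalue_iff)
  have "norm2 k = 0 \<or> norm2 k = 1 \<or> 2 \<le> norm2 k" using norm2_nonneg[of k] by linarith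
  then show ?thesis using k that by auto
qed

lemma torus_eigenvalue_low: "torus_eigenvalue 0" "torus_eigenvalue (4 * pi\<^sup>2)"
  using courant_sharp_0 courant_sharp_1 by (auto simp: courant_sharp_def torus_eigenvalue_def)

text \<open>The eigenvalue 0 occupies the index 1 alone; 4 pi^2 starts at index 2 and has
  multiplicity 4, so it ends at index 5.\<close>

lemma lambda_k_low: "lambda_k 1 = 0" "k \<in> {2..5} \<Longrightarrow> lambda_k k = 4 * pi\<^sup>2"
proof -
  show "lambda_k 1 = 0"
    unfolding lambda_k_def
  proof (rule the_equality)
    fix m assume m: "torus_eigenvalue m \<and> nu m \<le> 1 \<and> 1 < nu m + eig_mult m"
    then have "torus_eigenvalue m" by blast
    then show "m = 0" by (cases rule: torus_eigenvalue_cases) (use m nu_low nu_large in fastforce)+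
  qed (simp add: torus_eigenvalue_low nu_low)
  assume k: "k \<in> {2..5}"
  show "lambda_k k = 4 * pi\<^sup>2"
    unfolding lambda_k_def
  proof (rule the_equality)
    fix m assume m: "torus_eigenvalue m \<and> nu m \<le> k \<and> k < nu m + eig_mult m"
    then have "torus_eigenvalue m" by blast
    then show "m = 4 * pi\<^sup>2" by (cases rule: torus_eigenvalue_cases) (use m k nu_low nu_large in fastforce)+
  qed (use k in \<open>simp add: torus_eigenvalue_low nu_low\<close>)
qed

theorem theorem1:
  fixes lam :: real
  assumes "torus_eigenvalue lam"
  shows "(courant_sharp lam \<longleftrightarrow> (\<exists>k\<in>{1..5}. lam = lambda_k k))
       \<and> (courant_sharp lam \<longleftrightarrow> lam \<in> {0, 4 * pi ^ 2})"
proof -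
  have "courant_sharp lam \<longleftrightarrow> lam \<in> {0, 4 * pi ^ 2}"
    using assms
  proof (cases rule: torus_eigenvalue_cases)
    case (3 N)
    then show ?thesis using not_courant_sharp[of N] courant_sharp_0 courant_sharp_1 by auto
  qed (simp_all add: courant_sharp_0 courant_sharp_1)
  moreover have "(\<exists>k\<in>{1..5}. lam = lambda_k k) \<longleftrightarrow> lam \<in> {0, 4 * pi ^ 2}"
  proof -
    have "{1..5} = insert 1 {2..5::nat}" by auto
    then show ?thesis using lambda_k_low by auto
  qed
  ultimately show ?thesis by blast
qed

end
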